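(* For every collection $W$ of eight distinct MacMahon cubes, the number of MacMahon cubes $T$ for which $W$ has positive solution number is at most $5$. Moreover, exactly $360$ collections attain this maximum of $5$, and for each of these $360$ collections none of the five corresponding target cubes belongs to the collection.
   Context: A MacMahon cube is a cube whose six faces are painted with the six colors $1,\dots,6$, each color used on exactly one face, considered up to rotation; there are exactly $30$ MacMahon cubes. At each vertex of a cube three faces meet; reading their colors clockwise as seen from outside gives a cyclic triple, and the corner number of that vertex is the cyclic rotation of this triple with smallest three-digit value. Each MacMahon cube has $8$ distinct corner numbers. For a target MacMahon cube $T$ and a set $W$ of eight distinct MacMahon cubes, a solution is a bijection $\sigma$ from $W$ to the set of corner numbers of $T$ such that $\sigma(C)$ is a corner number of $C$ for every $C\in W$ (i.e. an arrangement of the eight cubes into a $2\times2\times2$ block whose exterior is colored like an enlarged $T$, with no condition on interior faces). The solution number of $W$ for $T$ is the number of such bijections; $W$ can build $T$ if this number is positive. *)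

theory Defs
  imports "HOL-Library.FuncSet"
begin

datatype face = Up | Down | Front | Back | Left | Right

text \<open>
  The quarter turns of the cube about its vertical and its left-right axis, as maps on the
  face positions. They generate the full group of 24 rotations; being of finite order, they
  do so without taking inverses.
\<close>

fun turn_vertical :: "face \<Rightarrow> face" where
  "turn_vertical Up = Up"
| "turn_vertical Down = Down"
| "turn_vertical Front = Left"
| "turn_vertical Left = Back"
| "turn_vertical Back = Right"
| "turn_vertical Right = Front"

fun turn_sideways :: "face \<Rightarrow> face" where
  "turn_sideways Left = Left"
| "turn_sideways Right = Right"
| "turn_sideways Up = Back"
| "turn_sideways Back = Down"
| "turn_sideways Down = Front"
| "turn_sideways Front = Up"

inductive_set rotations :: "(face \<Rightarrow> face) set" where
  "id \<in> rotations"
| "r \<in> rotations \<Longrightarrow> turn_vertical \<circ> r \<in> rotations"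
| "r \<in> rotations \<Longrightarrow> turn_sideways \<circ> r \<in> rotations"

definition paintings :: "(face \<Rightarrow> nat) set" where
  "paintings = {p. bij_betw p UNIV {1..6}}"

definition rotation_class :: "(face \<Rightarrow> nat) \<Rightarrow> (face \<Rightarrow> nat) set" where
  "rotation_class p = {p \<circ> r | r. r \<in> rotations}"

definition macmahon_cubes :: "(face \<Rightarrow> nat) set set" where
  "macmahon_cubes = rotation_class ` paintings"

text \<open>
  The eight vertices, each given by its three faces in clockwise order as seen from outside.
\<close>

definition vertices :: "(face \<times> face \<times> face) set" where
  "vertices =
    {(Up, Right, Front), (Up, Front, Left), (Up, Left, Back), (Up, Back, Right),
     (Down, Front, Right), (Down, Left, Front), (Down, Back, Left), (Down, Right, Back)}"

definition three_digit :: "nat \<Rightarrow> nat \<Rightarrow> nat \<Rightarrow> nat" where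
  "three_digit a b c = 100 * a + 10 * b + c"

fun corner_number :: "(face \<Rightarrow> nat) \<Rightarrow> face \<times> face \<times> face \<Rightarrow> nat" where
  "corner_number p (f, g, h) =
    Min {three_digit (p f) (p g) (p h),
         three_digit (p g) (p h) (p f),
         three_digit (p h) (p f) (p g)}"

text \<open>
  All paintings in a rotation class have the same corner numbers, since rotations permute the
  vertices and preserve the clockwise order up to cyclic shift; the union over the class is
  therefore the set of corner numbers of any representative.
\<close>

definition corner_numbers :: "(face \<Rightarrow> nat) set \<Rightarrow> nat set" where
  "corner_numbers C = (\<Union>p\<in>C. corner_number p ` vertices)"

definition collections :: "(face \<Rightarrow> nat) set set set" where
  "collections = {W. W \<subseteq> macmahon_cubes \<and> card W = 8}"

text \<open>
  Solutions are taken to be extensional functions, so that each bijection is counted once.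
\<close>

definition solutions ::
    "(face \<Rightarrow> nat) set set \<Rightarrow> (face \<Rightarrow> nat) set \<Rightarrow> ((face \<Rightarrow> nat) set \<Rightarrow> nat) set" where
  "solutions W T =
    {\<sigma> \<in> W \<rightarrow>\<^sub>E corner_numbers T.
      bij_betw \<sigma> W (corner_numbers T) \<and> (\<forall>C\<in>W. \<sigma> C \<in> corner_numbers C)}"

definition solution_number :: "(face \<Rightarrow> nat) set set \<Rightarrow> (face \<Rightarrow> nat) set \<Rightarrow> nat" where
  "solution_number W T = card (solutions W T)"

definition targets :: "(face \<Rightarrow> nat) set set \<Rightarrow> (face \<Rightarrow> nat) set set" where
  "targets W = {T \<in> macmahon_cubes. solution_number W T > 0}"

end

theory Submission
  imports Defs
begin

text \<open>
  The outer automorphism of the symmetric group on six letters identifies the 30 cubes with the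
  arcs \<open>(i, j)\<close>, \<open>i \<noteq> j\<close>, of the complete digraph on six points (MacMahon's 6-by-6 array), and
  the 40 corner numbers (3-cycles of colors) with the permutations \<open>\<pi>\<close> consisting of two
  3-cycles, in such a way that \<open>\<pi>\<close> is a corner of \<open>(i, j)\<close> iff \<open>\<pi> i = j\<close>. Hence \<open>(i, j)\<close> has no
  corner in common with \<open>(i, x)\<close>, \<open>(x, j)\<close> and \<open>(j, i)\<close>, so if \<open>W\<close> builds \<open>(i, j)\<close>, then no arc of
  \<open>W\<close> other than \<open>(i, j)\<close> leaves \<open>i\<close> or enters \<open>j\<close>, and \<open>(j, i)\<close> is not in \<open>W\<close>.

  These necessary conditions suffice for the upper bound: if \<open>C\<close> is the set of arcs satisfying
  them, \<open>P\<close> the set of tails and \<open>Q\<close> the set of heads of \<open>C\<close>, then \<open>W - C\<close> lies in the product of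
  the complements of \<open>P\<close> and \<open>Q\<close>, and comparing sizes shows that \<open>C\<close> has at most five elements.
  Equality forces \<open>C \<inter> W = {}\<close> and \<open>W = (Y \<union> U) \<times> (X \<union> U) - Y \<times> X - Id\<close> with
  \<open>X = P - Q\<close>, \<open>Y = Q - P\<close>, \<open>U\<close> the complement of \<open>P \<union> Q\<close>, \<open>|U| = 2\<close> and \<open>{|X|, |Y|} = {1, 2}\<close>.
  There are 360 such \<open>W\<close>, and each builds its five candidates: up to relabelling and reversal of
  arcs only three matchings have to be exhibited.
\<close>

subsection \<open>The cubes as arcs\<close>

text \<open>
  One representative painting per cube, as the list of colors of the faces
  \<open>Up, Down, Front, Back, Left, Right\<close>, keyed by the arc of the cube. The rows \<open>(i, _)\<close> and the
  columns \<open>(_, j)\<close> are the twelve sets of five cubes with pairwise no common corner number;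
  row \<open>i\<close> is matched with the unique column disjoint from it.
\<close>

definition cube_table :: "((nat \<times> nat) \<times> nat list) list" where
  "cube_table =
    [((0, 1), [1, 2, 3, 4, 5, 6]), ((0, 2), [1, 6, 2, 3, 5, 4]), ((0, 3), [1, 5, 2, 4, 6, 3]),
     ((0, 4), [1, 4, 2, 6, 3, 5]), ((0, 5), [1, 3, 2, 5, 4, 6]), ((1, 0), [1, 2, 3, 4, 6, 5]),
     ((1, 2), [1, 4, 2, 5, 3, 6]), ((1, 3), [1, 3, 2, 6, 4, 5]), ((1, 4), [1, 5, 2, 3, 6, 4]),
     ((1, 5), [1, 6, 2, 4, 5, 3]), ((2, 0), [1, 6, 2, 3, 4, 5]), ((2, 1), [1, 4, 2, 5, 6, 3]),
     ((2, 3), [1, 2, 3, 5, 4, 6]), ((2, 4), [1, 3, 2, 4, 5, 6]), ((2, 5), [1, 5, 2, 6, 3, 4]),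
     ((3, 0), [1, 5, 2, 4, 3, 6]), ((3, 1), [1, 3, 2, 6, 5, 4]), ((3, 2), [1, 2, 3, 5, 6, 4]),
     ((3, 4), [1, 6, 2, 5, 4, 3]), ((3, 5), [1, 4, 2, 3, 6, 5]), ((4, 0), [1, 4, 2, 6, 5, 3]),
     ((4, 1), [1, 5, 2, 3, 4, 6]), ((4, 2), [1, 3, 2, 4, 6, 5]), ((4, 3), [1, 6, 2, 5, 3, 4]),
     ((4, 5), [1, 2, 3, 6, 4, 5]), ((5, 0), [1, 3, 2, 5, 6, 4]), ((5, 1), [1, 6, 2, 4, 3, 5]),
     ((5, 2), [1, 5, 2, 6, 4, 3]), ((5, 3), [1, 4, 2, 3, 5, 6]), ((5, 4), [1, 2, 3, 6, 5, 4])]"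

definition corner_table :: "((nat \<times> nat) \<times> nat list) list" where
  "corner_table =
    [((0, 1), [135, 146, 154, 163, 236, 245, 253, 264]), ((0, 2), [125, 134, 142, 153, 246, 265, 356, 364]),
     ((0, 3), [126, 132, 143, 164, 235, 256, 345, 465]), ((0, 4), [123, 136, 152, 165, 243, 254, 346, 456]),
     ((0, 5), [124, 145, 156, 162, 234, 263, 354, 365]), ((1, 0), [136, 145, 153, 164, 235, 246, 254, 263]),
     ((1, 2), [123, 135, 156, 162, 243, 264, 345, 465]), ((1, 3), [124, 146, 152, 165, 234, 253, 356, 364]),
     ((1, 4), [126, 134, 142, 163, 245, 256, 354, 365]), ((1, 5), [125, 132, 143, 154, 236, 265, 346, 456]),
     ((2, 0), [124, 135, 143, 152, 256, 264, 346, 365]), ((2, 1), [126, 132, 153, 165, 234, 246, 354, 456]),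
     ((2, 3), [134, 145, 156, 163, 236, 243, 254, 265]), ((2, 4), [125, 146, 154, 162, 235, 263, 345, 364]),
     ((2, 5), [123, 136, 142, 164, 245, 253, 356, 465]), ((3, 0), [123, 134, 146, 162, 253, 265, 354, 456]),
     ((3, 1), [125, 142, 156, 164, 235, 243, 346, 365]), ((3, 2), [136, 143, 154, 165, 234, 245, 256, 263]),
     ((3, 4), [124, 132, 145, 153, 236, 264, 356, 465]), ((3, 5), [126, 135, 152, 163, 246, 254, 345, 364]),
     ((4, 0), [125, 132, 156, 163, 234, 245, 364, 465]), ((4, 1), [124, 136, 143, 162, 254, 265, 345, 356]),
     ((4, 2), [126, 145, 152, 164, 236, 253, 346, 354]), ((4, 3), [123, 135, 142, 154, 246, 263, 365, 456]),
     ((4, 5), [134, 146, 153, 165, 235, 243, 256, 264]), ((5, 0), [126, 142, 154, 165, 236, 243, 345, 356]),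
     ((5, 1), [123, 134, 145, 152, 256, 263, 364, 465]), ((5, 2), [124, 132, 146, 163, 235, 254, 365, 456]),
     ((5, 3), [125, 136, 153, 162, 245, 264, 346, 354]), ((5, 4), [135, 143, 156, 164, 234, 246, 253, 265])]"

text \<open>
  An entry \<open>(b, c, d, e, f, n)\<close> says that the corner number \<open>n\<close> corresponds to the permutation
  with the cycles \<open>(0 b c)\<close> and \<open>(d e f)\<close>.
\<close>

definition triangles_table :: "(nat \<times> nat \<times> nat \<times> nat \<times> nat \<times> nat) list" where
  "triangles_table =
    [(1, 2, 3, 4, 5, 264), (1, 2, 3, 5, 4, 135), (1, 3, 2, 4, 5, 146), (1, 3, 2, 5, 4, 253),
     (1, 4, 2, 3, 5, 163), (1, 4, 2, 5, 3, 245), (1, 5, 2, 3, 4, 236), (1, 5, 2, 4, 3, 154),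
     (2, 1, 3, 4, 5, 153), (2, 1, 3, 5, 4, 246), (2, 3, 1, 4, 5, 134), (2, 3, 1, 5, 4, 265),
     (2, 4, 1, 3, 5, 364), (2, 4, 1, 5, 3, 125), (2, 5, 1, 3, 4, 356), (2, 5, 1, 4, 3, 142),
     (3, 1, 2, 4, 5, 235), (3, 1, 2, 5, 4, 164), (3, 2, 1, 4, 5, 256), (3, 2, 1, 5, 4, 143),
     (3, 4, 1, 2, 5, 465), (3, 4, 1, 5, 2, 132), (3, 5, 1, 2, 4, 345), (3, 5, 1, 4, 2, 126),
     (4, 1, 2, 3, 5, 254), (4, 1, 2, 5, 3, 136), (4, 2, 1, 3, 5, 152), (4, 2, 1, 5, 3, 346),
     (4, 3, 1, 2, 5, 123), (4, 3, 1, 5, 2, 456), (4, 5, 1, 2, 3, 243), (4, 5, 1, 3, 2, 165),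
     (5, 1, 2, 3, 4, 145), (5, 1, 2, 4, 3, 263), (5, 2, 1, 3, 4, 124), (5, 2, 1, 4, 3, 365),
     (5, 3, 1, 2, 4, 162), (5, 3, 1, 4, 2, 354), (5, 4, 1, 2, 3, 156), (5, 4, 1, 3, 2, 234)]"

section \<open>Corner numbers computed from color lists\<close>

definition least_rotation :: "nat \<Rightarrow> nat \<Rightarrow> nat \<Rightarrow> nat" where
  "least_rotation a b c =
    min (three_digit a b c) (min (three_digit b c a) (three_digit c a b))"

fun list_corners :: "nat list \<Rightarrow> nat list" where
  "list_corners [u, d, f, b, l, r] =
    [least_rotation u r f, least_rotation u f l, least_rotation u l b, least_rotation u b r,
     least_rotation d f r, least_rotation d l f, least_rotation d b l, least_rotation d r b]"
| "list_corners _ = []"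

fun painting_of :: "nat list \<Rightarrow> face \<Rightarrow> nat" where
  "painting_of xs Up = xs ! 0"
| "painting_of xs Down = xs ! 1"
| "painting_of xs Front = xs ! 2"
| "painting_of xs Back = xs ! 3"
| "painting_of xs Left = xs ! 4"
| "painting_of xs Right = xs ! 5"

lemma corner_number_eq_least_rotation:
  "corner_number p (f, g, h) = least_rotation (p f) (p g) (p h)"
  by (simp add: least_rotation_def)

lemma least_rotation_rotate: "least_rotation b c a = least_rotation a b c"
  by (simp add: least_rotation_def min.commute min.left_commute)

text \<open>A turn may send a listed vertex triple to a cyclic shift of another one, so
  \<open>vertices\<close> itself is not invariant under rotations; this closure is.\<close>

definition oriented_vertices :: "(face \<times> face \<times> face) set" where
  "oriented_vertices = (\<Union>(f, g, h)\<in>vertices. {(f, g, h), (g, h, f), (h, f, g)})"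

lemma turns_oriented_vertices:
  assumes "(f, g, h) \<in> oriented_vertices"
  shows "(turn_vertical f, turn_vertical g, turn_vertical h) \<in> oriented_vertices"
    and "(turn_sideways f, turn_sideways g, turn_sideways h) \<in> oriented_vertices"
proof -
  have "\<forall>(f, g, h)\<in>oriented_vertices.
    (turn_vertical f, turn_vertical g, turn_vertical h) \<in> oriented_vertices \<and>
    (turn_sideways f, turn_sideways g, turn_sideways h) \<in> oriented_vertices"
    by (simp add: oriented_vertices_def vertices_def)
  with assms
  show "(turn_vertical f, turn_vertical g, turn_vertical h) \<in> oriented_vertices"
    and "(turn_sideways f, turn_sideways g, turn_sideways h) \<in> oriented_vertices"
    by blast+
qed

lemma rotations_oriented_vertices:
  assumes "r \<in> rotations" "(f, g, h) \<in> oriented_vertices"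
  shows "(r f, r g, r h) \<in> oriented_vertices"
  using assms
proof (induction rule: rotations.induct)
  case 1
  then show ?case by simp
next
  case (2 r)
  then show ?case using turns_oriented_vertices(1) by simp
next
  case (3 r)
  then show ?case using turns_oriented_vertices(2) by simp
qed

lemma corner_number_oriented_vertices:
  assumes "(f, g, h) \<in> oriented_vertices"
  shows "corner_number p (f, g, h) \<in> corner_number p ` vertices"
proof -
  obtain f' g' h' where "(f', g', h') \<in> vertices"
    and "(f, g, h) \<in> {(f', g', h'), (g', h', f'), (h', f', g')}"
    using assms by (auto simp: oriented_vertices_def)
  then have "corner_number p (f, g, h) = corner_number p (f', g', h')"
    unfolding corner_number_eq_least_rotation by (auto simp: least_rotation_rotate)
  then show ?thesis
    using \<open>(f', g', h') \<in> vertices\<close> by blast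
qed

text \<open>A rotation moves a vertex to an oriented vertex, and taking the least rotation forgets
  the cyclic shift. Hence every painting of the class contributes the same numbers.\<close>

lemma corner_numbers_rotation_class:
  "corner_numbers (rotation_class p) = corner_number p ` vertices"
proof
  have "corner_number (p \<circ> r) (f, g, h) \<in> corner_number p ` vertices"
    if "r \<in> rotations" "(f, g, h) \<in> vertices" for r f g h
  proof -
    have "(f, g, h) \<in> oriented_vertices"
      using that(2) by (auto simp: oriented_vertices_def)
    from corner_number_oriented_vertices[OF rotations_oriented_vertices[OF that(1) this]]
    show ?thesis by simp
  qed
  then show "corner_numbers (rotation_class p) \<subseteq> corner_number p ` vertices"
    by (auto simp: corner_numbers_def rotation_class_def simp del: corner_number.simps)
  have "p \<in> rotation_class p"
    using rotations.intros(1) by (auto simp: rotation_class_def intro: exI[of _ id])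
  then show "corner_number p ` vertices \<subseteq> corner_numbers (rotation_class p)"
    by (auto simp: corner_numbers_def)
qed

lemma corner_numbers_painting_of:
  assumes "length xs = 6"
  shows "corner_numbers (rotation_class (painting_of xs)) = set (list_corners xs)"
proof -
  obtain u d f b l r where "xs = [u, d, f, b, l, r]"
    using assms by (auto simp: length_Suc_conv numeral_eq_Suc)
  then show ?thesis
    unfolding corner_numbers_rotation_class vertices_def image_insert image_empty
      corner_number_eq_least_rotation by (simp add: numeral_eq_Suc)
qed

section \<open>The rotation group and its action on paintings\<close>

lemma rotations_comp: "r \<in> rotations \<Longrightarrow> s \<in> rotations \<Longrightarrow> r \<circ> s \<in> rotations"
proof (induction rule: rotations.induct)
  case 1
  then show ?case by simp
next
  case (2 r)
  then show ?case unfolding comp_assoc by (blast intro: rotations.intros)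
next
  case (3 r)
  then show ?case unfolding comp_assoc by (blast intro: rotations.intros)
qed

lemma turns_in_rotations: "turn_vertical \<in> rotations" "turn_sideways \<in> rotations"
  using rotations.intros(2,3)[OF rotations.intros(1)] by simp_all

lemma turn_vertical_power4: "turn_vertical \<circ> (turn_vertical \<circ> turn_vertical \<circ> turn_vertical) = id"
proof
  show "(turn_vertical \<circ> (turn_vertical \<circ> turn_vertical \<circ> turn_vertical)) f = id f" for f
    by (cases f) auto
qed

lemma turn_sideways_power4: "turn_sideways \<circ> (turn_sideways \<circ> turn_sideways \<circ> turn_sideways) = id"
proof
  show "(turn_sideways \<circ> (turn_sideways \<circ> turn_sideways \<circ> turn_sideways)) f = id f" for f
    by (cases f) auto
qed

text \<open>Induction along the generators: the inverse of a quarter turn is its third power,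
  appended on the right of the inverse already found.\<close>

lemma rotations_right_inverse: "r \<in> rotations \<Longrightarrow> \<exists>s\<in>rotations. r \<circ> s = id"
proof (induction rule: rotations.induct)
  case 1
  show ?case by (rule bexI[of _ id]) (simp_all only: comp_id rotations.intros(1))
next
  case (2 r)
  then obtain s where s: "s \<in> rotations" "r \<circ> s = id" by blast
  let ?s = "s \<circ> (turn_vertical \<circ> turn_vertical \<circ> turn_vertical)"
  have "?s \<in> rotations"
    by (intro rotations_comp s turns_in_rotations)
  moreover have "(turn_vertical \<circ> r) \<circ> ?s = id"
  proof -
    have "(turn_vertical \<circ> r) \<circ> ?s = turn_vertical \<circ> (r \<circ> s) \<circ> (turn_vertical \<circ> turn_vertical \<circ> turn_vertical)"
      by (simp only: comp_assoc)
    then show ?thesis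
      by (simp only: s(2) comp_id turn_vertical_power4)
  qed
  ultimately show ?case by blast
next
  case (3 r)
  then obtain s where s: "s \<in> rotations" "r \<circ> s = id" by blast
  let ?s = "s \<circ> (turn_sideways \<circ> turn_sideways \<circ> turn_sideways)"
  have "?s \<in> rotations"
    by (intro rotations_comp s turns_in_rotations)
  moreover have "(turn_sideways \<circ> r) \<circ> ?s = id"
  proof -
    have "(turn_sideways \<circ> r) \<circ> ?s = turn_sideways \<circ> (r \<circ> s) \<circ> (turn_sideways \<circ> turn_sideways \<circ> turn_sideways)"
      by (simp only: comp_assoc)
    then show ?thesis
      by (simp only: s(2) comp_id turn_sideways_power4)
  qed
  ultimately show ?case by blast
qed

lemma rotation_class_comp:
  assumes "r \<in> rotations"
  shows "rotation_class (p \<circ> r) = rotation_class p"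
proof -
  have sub: "rotation_class (q \<circ> s) \<subseteq> rotation_class q" if "s \<in> rotations" for q s
    using rotations_comp[OF that] by (auto simp: rotation_class_def comp_assoc)
  obtain s where s: "s \<in> rotations" "r \<circ> s = id"
    using rotations_right_inverse[OF assms] by blast
  have "rotation_class p = rotation_class ((p \<circ> r) \<circ> s)"
    using s(2) by (simp add: comp_assoc)
  then show ?thesis
    using sub[OF assms] sub[OF s(1)] by blast
qed

lemma rotation_of_Up: "\<exists>r\<in>rotations. r Up = f"
proof -
  let ?v = turn_vertical and ?s = turn_sideways
  have "\<exists>r\<in>{id, ?s, ?s \<circ> ?s, ?s \<circ> ?s \<circ> ?s, ?v \<circ> ?s, ?v \<circ> ?v \<circ> ?v \<circ> ?s}. r Up = f"
    by (cases f) simp_all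
  moreover have "{id, ?s, ?s \<circ> ?s, ?s \<circ> ?s \<circ> ?s, ?v \<circ> ?s, ?v \<circ> ?v \<circ> ?v \<circ> ?s} \<subseteq> rotations"
    by (simp add: rotations_comp turns_in_rotations rotations.intros(1))
  ultimately show ?thesis by blast
qed

lemma rotation_of_Front:
  assumes "f \<noteq> Up" "f \<noteq> Down"
  shows "\<exists>r\<in>rotations. r Up = Up \<and> r Down = Down \<and> r Front = f"
proof -
  let ?v = turn_vertical
  have "\<exists>r\<in>{id, ?v, ?v \<circ> ?v, ?v \<circ> ?v \<circ> ?v}. r Up = Up \<and> r Down = Down \<and> r Front = f"
    using assms by (cases f) simp_all
  moreover have "{id, ?v, ?v \<circ> ?v, ?v \<circ> ?v \<circ> ?v} \<subseteq> rotations"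
    by (simp add: rotations_comp turns_in_rotations rotations.intros(1))
  ultimately show ?thesis by blast
qed

lemma rotations_bij: "r \<in> rotations \<Longrightarrow> bij r"
proof (induction rule: rotations.induct)
  case (2 r)
  have "bij turn_vertical"
    using turn_vertical_power4 by (intro o_bij) (simp_all only: comp_assoc)
  with 2 show ?case by (blast intro: bij_comp)
next
  case (3 r)
  have "bij turn_sideways"
    using turn_sideways_power4 by (intro o_bij) (simp_all only: comp_assoc)
  with 3 show ?case by (blast intro: bij_comp)
qed (rule bij_id)

lemma UNIV_face: "UNIV = {Up, Down, Front, Back, Left, Right}"
  by (auto intro: face.exhaust)

lemma paintings_comp:
  assumes "p \<in> paintings" "r \<in> rotations"
  shows "p \<circ> r \<in> paintings"
  using assms bij_betw_trans[OF rotations_bij] unfolding paintings_def by blast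

section \<open>Normal forms of paintings and the list of cubes\<close>

lemma normalised_colors_in_cube_table:
  assumes "distinct [1, d, f, b, l, r]" "{d, f, b, l, r} \<subseteq> {1..6}"
    and "f = (if d = 2 then 3 else 2)"
  shows "[1, d, f, b, l, r] \<in> set (map snd cube_table)"
proof -
  \<comment> \<open>Color 1 on top and the least side color in front use up all 24 rotations. There
    remain 5 choices for the bottom and 3! for the other faces: the 30 lists of the table.\<close>
  have "\<forall>d\<in>{2, 3, 4, 5, 6 :: nat}. \<forall>b\<in>{2, 3, 4, 5, 6} - {d, if d = 2 then 3 else 2}.
    \<forall>l\<in>{2, 3, 4, 5, 6} - {d, if d = 2 then 3 else 2, b}.
    \<forall>r\<in>{2, 3, 4, 5, 6} - {d, if d = 2 then 3 else 2, b, l}.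
    [1, d, if d = 2 then 3 else 2, b, l, r] \<in> set (map snd cube_table)"
    by (simp add: cube_table_def insert_Diff_if)
  moreover have "{d, b, l, r} \<subseteq> {2, 3, 4, 5, 6}"
  proof
    fix c assume "c \<in> {d, b, l, r}"
    then have "1 \<le> c" "c \<le> 6" "c \<noteq> 1"
      using assms(1,2) by auto
    then show "c \<in> {2, 3, 4, 5, 6}" by auto
  qed
  moreover have "b \<notin> {d, f}" "l \<notin> {d, f, b}" "r \<notin> {d, f, b, l}"
    using assms(1) by auto
  ultimately show ?thesis
    unfolding assms(3) by blast
qed

lemma rotation_class_in_table:
  assumes "p \<in> paintings"
  shows "\<exists>xs\<in>set (map snd cube_table). rotation_class p = rotation_class (painting_of xs)"
proof -
  have surj: "\<exists>f. q f = c" if "q \<in> paintings" "c \<in> {1..6}" for q and c :: nat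
    using that unfolding paintings_def bij_betw_def by (metis (mono_tags) imageE mem_Collect_eq)
  obtain g where g: "p g = 1" using surj[OF assms, of 1] by auto
  obtain r where r: "r \<in> rotations" "r Up = g" using rotation_of_Up by blast
  define q where "q = p \<circ> r"
  have q: "q \<in> paintings" "q Up = 1" "rotation_class q = rotation_class p"
    using paintings_comp[OF assms r(1)] g r rotation_class_comp by (auto simp: q_def)
  \<comment> \<open>With 1 on top, \<open>m\<close> is the least color on the four side faces; a
    rotation about the vertical axis brings it to the front.\<close>
  define m where "m = (if q Down = 2 then 3 else 2 :: nat)"
  have "m \<in> {1..6}" by (simp add: m_def)
  then obtain h where h: "q h = m" using surj[OF q(1)] by blast
  have "h \<noteq> Up" "h \<noteq> Down" using h q(2) by (auto simp: m_def split: if_splits)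
  then obtain s where s: "s \<in> rotations" "s Up = Up" "s Down = Down" "s Front = h"
    using rotation_of_Front by blast
  define t where "t = q \<circ> s"
  have t: "t \<in> paintings" "t Up = 1" "rotation_class t = rotation_class p"
    "t Front = (if t Down = 2 then 3 else 2)"
    using paintings_comp[OF q(1) s(1)] q s h rotation_class_comp by (auto simp: t_def m_def)
  let ?xs = "[1, t Down, t Front, t Back, t Left, t Right]"
  have "inj t" "range t = {1..6}"
    using t(1) by (auto simp: paintings_def bij_betw_def)
  then have "distinct [t Up, t Down, t Front, t Back, t Left, t Right]"
    by (auto dest: injD)
  moreover have "{t Down, t Front, t Back, t Left, t Right} \<subseteq> {1..6}"
    using \<open>range t = {1..6}\<close> by blast
  ultimately have "?xs \<in> set (map snd cube_table)"
    using t(2,4) by (intro normalised_colors_in_cube_table) auto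
  moreover have "painting_of ?xs = t"
  proof
    show "painting_of ?xs f = t f" for f
      by (cases f) (use t(2) in \<open>simp_all add: numeral_eq_Suc\<close>)
  qed
  ultimately show ?thesis using t(3) by metis
qed

lemma painting_of_in_paintings:
  assumes "xs \<in> set (map snd cube_table)"
  shows "painting_of xs \<in> paintings"
proof -
  have "\<forall>xs\<in>set (map snd cube_table). length xs = 6 \<and> distinct xs \<and> set xs = {1..6}"
  proof -
    have eq: "{1..6} = {1, 2, 3, 4, 5, 6 :: nat}" by auto
    show ?thesis unfolding cube_table_def eq by (simp add: set_eq_subset)
  qed
  then have xs: "length xs = 6" "distinct xs" "set xs = {1..6}" using assms by blast+
  obtain u d f b l r where "xs = [u, d, f, b, l, r]"
    using xs(1) by (auto simp: length_Suc_conv numeral_eq_Suc)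
  then show ?thesis
    using xs(2,3) unfolding paintings_def bij_betw_def UNIV_face
    by (simp add: numeral_eq_Suc eq_commute)
qed

section \<open>The dictionary between arcs and cubes\<close>

definition arcs :: "(nat \<times> nat) set" where
  "arcs = {..<6} \<times> {..<6} - Id"

definition cube :: "nat \<times> nat \<Rightarrow> (face \<Rightarrow> nat) set" where
  "cube e = rotation_class (painting_of (the (map_of cube_table e)))"

definition corners :: "nat \<times> nat \<Rightarrow> nat set" where
  "corners e = set (the (map_of corner_table e))"

lemma lessThan_6: "{..<6} = {0, 1, 2, 3, 4, 5 :: nat}"
  by auto

lemma keys_cube_table: "fst ` set cube_table = arcs"
  unfolding arcs_def lessThan_6 cube_table_def
  by (simp add: insert_Diff_if set_eq_subset Sigma_def)

text \<open>Sorting makes each list canonical, so that equality of corner sets can later be tested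
  on lists.\<close>

lemma corner_table_eq: "corner_table = map (\<lambda>(e, xs). (e, sort (list_corners xs))) cube_table"
  by (simp add: corner_table_def cube_table_def least_rotation_def three_digit_def)

lemma length_cube_table_entry: "xs \<in> set (map snd cube_table) \<Longrightarrow> length xs = 6"
  by (auto simp: cube_table_def)

lemma cube_table_lookup:
  assumes "e \<in> arcs"
  obtains xs where "map_of cube_table e = Some xs" "xs \<in> set (map snd cube_table)"
proof -
  obtain xs where "map_of cube_table e = Some xs"
    using assms unfolding keys_cube_table[symmetric]
    by (metis domD dom_map_of_conv_image_fst)
  then show ?thesis using that map_of_SomeD by force
qed

lemma corner_numbers_cube:
  assumes "e \<in> arcs"
  shows "corner_numbers (cube e) = corners e"
proof -
  obtain xs where xs: "map_of cube_table e = Some xs" "xs \<in> set (map snd cube_table)"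
    using cube_table_lookup[OF assms] .
  have "map_of corner_table e = Some (sort (list_corners xs))"
    using xs(1) by (simp add: corner_table_eq map_of_map)
  then show ?thesis
    using xs length_cube_table_entry
    by (simp add: corners_def cube_def corner_numbers_painting_of)
qed

lemma macmahon_cubes_eq: "macmahon_cubes = cube ` arcs"
proof
  have distinct: "distinct (map fst cube_table)"
    by (simp add: cube_table_def)
  show "macmahon_cubes \<subseteq> cube ` arcs"
  proof
    fix C assume "C \<in> macmahon_cubes"
    then obtain xs where xs: "xs \<in> set (map snd cube_table)" "C = rotation_class (painting_of xs)"
      using rotation_class_in_table unfolding macmahon_cubes_def by blast
    then obtain e where "(e, xs) \<in> set cube_table" by auto
    then have "map_of cube_table e = Some xs"
      using distinct by simp
    moreover have "e \<in> arcs"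
      unfolding keys_cube_table[symmetric] using \<open>(e, xs) \<in> set cube_table\<close> by force
    ultimately show "C \<in> cube ` arcs" using xs(2)
      by (intro image_eqI[of _ _ e]) (simp_all add: cube_def)
  qed
  show "cube ` arcs \<subseteq> macmahon_cubes"
  proof
    fix C assume "C \<in> cube ` arcs"
    then obtain e where e: "e \<in> arcs" "C = cube e" by blast
    obtain xs where "map_of cube_table e = Some xs" "xs \<in> set (map snd cube_table)"
      using cube_table_lookup[OF e(1)] .
    then show "C \<in> macmahon_cubes"
      using painting_of_in_paintings e(2) by (simp add: macmahon_cubes_def cube_def)
  qed
qed

text \<open>The incidence rule of the dictionary, verified by evaluating all 40 times 30 pairs: the
  six listed arcs are the graph of the permutation.\<close>

lemma triangles_table_corner:
  assumes "(b, c, d, e, f, n) \<in> set triangles_table" "(a, ns) \<in> set corner_table"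
  shows "n \<in> set ns \<longleftrightarrow> a \<in> {(0, b), (b, c), (c, 0), (d, e), (e, f), (f, d)}"
proof -
  have "\<forall>(b, c, d, e, f, n)\<in>set triangles_table. \<forall>(a, ns)\<in>set corner_table.
    n \<in> set ns \<longleftrightarrow> a \<in> {(0, b), (b, c), (c, 0), (d, e), (e, f), (f, d)}"
    by (simp add: triangles_table_def corner_table_def)
  from bspec[OF this assms(1)]
  have "\<forall>(a, ns)\<in>set corner_table.
    n \<in> set ns \<longleftrightarrow> a \<in> {(0, b), (b, c), (c, 0), (d, e), (e, f), (f, d)}"
    by (simp only: prod.case)
  from bspec[OF this assms(2)] show ?thesis
    by (simp only: prod.case)
qed

text \<open>The keys are normalised: the first cycle starts at 0 and the second at its least
  element. There are 5 * 4 * 2 = 40 such keys.\<close>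

lemma triangles_table_complete:
  "\<forall>b\<in>{1, 2, 3, 4, 5}. \<forall>c\<in>{1, 2, 3, 4, 5} - {b}. \<forall>d\<in>{1, 2, 3, 4, 5} - {b, c}.
    \<forall>e\<in>{1, 2, 3, 4, 5} - {b, c, d}. \<forall>f\<in>{1, 2, 3, 4, 5} - {b, c, d, e}.
    d < e \<and> d < f \<longrightarrow> (b, c, d, e, f) \<in> (\<lambda>(b, c, d, e, f, n). (b, c, d, e, f)) ` set triangles_table"
  by (simp add: triangles_table_def insert_Diff_if)

lemma distinct_triangles_table:
  "\<forall>(b, c, d, e, f, n)\<in>set triangles_table. distinct [0, b, c, d, e, f]"
  by (simp add: triangles_table_def)

lemma corner_table_entries:
  "\<forall>(e, ns)\<in>set corner_table. sorted ns \<and> distinct ns \<and> length ns = 8 \<and>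
    set ns \<subseteq> (\<lambda>(b, c, d, e, f, n). n) ` set triangles_table"
  by (simp add: triangles_table_def corner_table_def)

lemma distinct_corner_table: "distinct (map snd corner_table)" "distinct (map fst corner_table)"
  by (simp_all add: corner_table_def)

lemma corner_table_lookup:
  assumes "e \<in> arcs"
  obtains ns where "(e, ns) \<in> set corner_table" "corners e = set ns"
proof -
  have "fst ` set corner_table = arcs"
    unfolding corner_table_eq by (force simp: keys_cube_table[symmetric])
  then have "e \<in> fst ` set corner_table" using assms by blast
  then obtain ns where "(e, ns) \<in> set corner_table" by auto
  then show ?thesis
    using that distinct_corner_table(2) by (simp add: corners_def)
qed

lemma card_corners:
  assumes "e \<in> arcs"
  shows "card (corners e) = 8"
proof -
  obtain ns where ns: "(e, ns) \<in> set corner_table" "corners e = set ns"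
    using corner_table_lookup[OF assms] .
  have "distinct ns" "length ns = 8"
    using corner_table_entries ns(1) by blast+
  then show ?thesis using ns(2) by (simp add: distinct_card)
qed

lemma inj_on_corners: "inj_on corners arcs"
proof
  fix e e' assume "e \<in> arcs" "e' \<in> arcs" and eq: "corners e = corners e'"
  obtain ns where ns: "(e, ns) \<in> set corner_table" "corners e = set ns"
    using corner_table_lookup[OF \<open>e \<in> arcs\<close>] .
  obtain ns' where ns': "(e', ns') \<in> set corner_table" "corners e' = set ns'"
    using corner_table_lookup[OF \<open>e' \<in> arcs\<close>] .
  have "sorted ns" "distinct ns" "sorted ns'" "distinct ns'"
    using corner_table_entries ns(1) ns'(1) by blast+
  then have "ns = ns'"
    using ns(2) ns'(2) eq by (intro sorted_distinct_set_unique) auto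
  moreover have "inj_on snd (set corner_table)"
    using distinct_corner_table(1) by (simp add: distinct_map)
  ultimately show "e = e'"
    using inj_onD[of snd _ "(e, ns)" "(e', ns')"] ns(1) ns'(1) by auto
qed

text \<open>The rotation classes are told apart by their corner sets, without comparing
  paintings.\<close>

lemma inj_on_cube: "inj_on cube arcs"
  using inj_on_corners corner_numbers_cube unfolding inj_on_def by metis

text \<open>A common corner puts both arcs into the graph of one permutation. Such a graph has one
  arc out of and one arc into each point, and a 3-cycle never contains an arc together with its
  reverse.\<close>

lemma common_corner:
  assumes "(i, j) \<in> arcs" "(k, l) \<in> arcs" "corners (i, j) \<inter> corners (k, l) \<noteq> {}"
  shows "i = k \<longleftrightarrow> j = l" "\<not> (i = l \<and> j = k)"
proof -
  obtain n where n: "n \<in> corners (i, j)" "n \<in> corners (k, l)" using assms(3) by blast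
  obtain ns where ns: "((i, j), ns) \<in> set corner_table" "corners (i, j) = set ns"
    using corner_table_lookup[OF assms(1)] .
  obtain ms where ms: "((k, l), ms) \<in> set corner_table" "corners (k, l) = set ms"
    using corner_table_lookup[OF assms(2)] .
  have "set ns \<subseteq> (\<lambda>(b, c, d, e, f, n). n) ` set triangles_table"
    using corner_table_entries ns(1) by blast
  then obtain b c d e f where t: "(b, c, d, e, f, n) \<in> set triangles_table"
    using n(1) ns(2) by auto
  let ?A = "{(0, b), (b, c), (c, 0), (d, e), (e, f), (f, d)}"
  have *: "n \<in> set xs \<longleftrightarrow> a \<in> ?A" if "(a, xs) \<in> set corner_table" for a xs
    using triangles_table_corner[OF t that] .
  have "(i, j) \<in> ?A"
    using *[OF ns(1)] n(1) ns(2) by simp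
  moreover have "(k, l) \<in> ?A"
    using *[OF ms(1)] n(2) ms(2) by simp
  moreover have "distinct [0, b, c, d, e, f]"
    using distinct_triangles_table t by blast
  ultimately show "i = k \<longleftrightarrow> j = l" "\<not> (i = l \<and> j = k)"
    by auto
qed

section \<open>Corner numbers as pairs of directed triangles\<close>

definition triangle :: "'a \<Rightarrow> 'a \<Rightarrow> 'a \<Rightarrow> ('a \<times> 'a) set" where
  "triangle a b c = {(a, b), (b, c), (c, a)}"

definition triangle_pairs :: "(nat \<times> nat) set set" where
  "triangle_pairs = {triangle a b c \<union> triangle d e f | a b c d e f.
    distinct [a, b, c, d, e, f] \<and> {a, b, c, d, e, f} = {..<6}}"

text \<open>Exchanging the triangles puts 0 into the first, and rotating each one makes it start at
  0 and at its minimum respectively. This is the form of the keys in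
  \<open>triangles_table\<close>.\<close>

lemma triangle_pairs_normal_form:
  assumes "S \<in> triangle_pairs"
  obtains b c d e f where "S = triangle 0 b c \<union> triangle d e f"
    "distinct [0, b, c, d, e, f]" "{0, b, c, d, e, f} = {..<6}" "d < e" "d < f"
proof -
  obtain a b c d e f where S': "S = triangle a b c \<union> triangle d e f"
    "distinct [a, b, c, d, e, f]" "{a, b, c, d, e, f} = {..<6}"
    using assms unfolding triangle_pairs_def by blast
  obtain a b c d e f where S: "S = triangle a b c \<union> triangle d e f"
    "{a, b, c} \<union> {d, e, f} = {..<6}" "0 \<in> {a, b, c}"
  proof (cases "0 \<in> {a, b, c}")
    case True
    have "{a, b, c} \<union> {d, e, f} = {..<6}" unfolding S'(3)[symmetric] by blast
    then show ?thesis by (rule that[OF S'(1) _ True])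
  next
    case False
    moreover have "0 \<in> {a, b, c, d, e, f}" unfolding S'(3) by simp
    ultimately have "0 \<in> {d, e, f}" by simp
    moreover have "S = triangle d e f \<union> triangle a b c" unfolding S'(1) by (rule Un_commute)
    moreover have "{d, e, f} \<union> {a, b, c} = {..<6}" unfolding S'(3)[symmetric] by blast
    ultimately show ?thesis by (intro that)
  qed
  have rot: "\<exists>y' z'. triangle x y z = triangle v y' z' \<and> {x, y, z} = {v, y', z'}"
    if v: "v \<in> {x, y, z}" for v x y z :: nat
  proof -
    have "triangle x y z = triangle y z x" "{x, y, z} = {y, z, x}"
      "triangle x y z = triangle z x y" "{x, y, z} = {z, x, y}"
      by (auto simp: triangle_def)
    then show ?thesis using v by (metis insertE singletonD)
  qed
  obtain b' c' where 1: "triangle a b c = triangle 0 b' c'" "{a, b, c} = {0, b', c'}"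
    using rot[OF S(3)] by (elim exE conjE)
  have "Min {d, e, f} \<in> {d, e, f}" by (rule Min_in) auto
  from rot[OF this] obtain d' e' f' where d': "d' = Min {d, e, f}"
    and 2: "triangle d e f = triangle d' e' f'" "{d, e, f} = {d', e', f'}"
    by (elim exE conjE) blast
  have set: "{0, b', c', d', e', f'} = {..<6}"
    using S(2) unfolding 1(2) 2(2) by (simp only: Un_insert_left Un_empty_left)
  \<comment> \<open>Six entries covering a set of six elements cannot repeat.\<close>
  have distinct: "distinct [0, b', c', d', e', f']"
  proof (rule card_distinct)
    show "card (set [0, b', c', d', e', f']) = length [0, b', c', d', e', f']"
      using set by simp
  qed
  then have "d' \<noteq> e'" "d' \<noteq> f'" by simp_all
  moreover have "d' \<le> e'" "d' \<le> f'"
    using d' unfolding 2(2) by auto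
  ultimately have "d' < e'" "d' < f'"
    by (simp_all only: order_less_le simp_thms)
  with S(1) distinct set show ?thesis
    unfolding 1(1) 2(1) by (rule that)
qed

lemma corner_of_triangle_pair:
  assumes "S \<in> triangle_pairs"
  shows "\<exists>n. \<forall>a\<in>arcs. n \<in> corners a \<longleftrightarrow> a \<in> S"
proof -
  obtain b c d e f where S: "S = triangle 0 b c \<union> triangle d e f"
    "distinct [0, b, c, d, e, f]" "{0, b, c, d, e, f} = {..<6}" "d < e" "d < f"
    using triangle_pairs_normal_form[OF assms] .
  have "{b, c, d, e, f} = {..<6} - {0}"
    using S(2,3) by auto
  also have "\<dots> = {1, 2, 3, 4, 5}" by auto
  finally have "{b, c, d, e, f} = {1, 2, 3, 4, 5}" .
  then have "b \<in> {1, 2, 3, 4, 5}" "c \<in> {1, 2, 3, 4, 5} - {b}" "d \<in> {1, 2, 3, 4, 5} - {b, c}"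
    "e \<in> {1, 2, 3, 4, 5} - {b, c, d}" "f \<in> {1, 2, 3, 4, 5} - {b, c, d, e}"
    using S(2) by auto
  then have "(b, c, d, e, f) \<in> (\<lambda>(b, c, d, e, f, n). (b, c, d, e, f)) ` set triangles_table"
    using triangles_table_complete S(4,5) by blast
  then obtain n where t: "(b, c, d, e, f, n) \<in> set triangles_table" by auto
  have "n \<in> corners a \<longleftrightarrow> a \<in> S" if a: "a \<in> arcs" for a
  proof -
    obtain ns where ns: "(a, ns) \<in> set corner_table" "corners a = set ns"
      using corner_table_lookup[OF a] .
    have "n \<in> set ns \<longleftrightarrow> a \<in> {(0, b), (b, c), (c, 0), (d, e), (e, f), (f, d)}"
      using triangles_table_corner[OF t ns(1)] .
    then show ?thesis using ns(2) by (auto simp: S(1) triangle_def)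
  qed
  then show ?thesis by blast
qed

subsection \<open>Counting candidates\<close>

text \<open>The arcs that the obstructions of \<open>common_corner\<close> leave as possible
  targets. Corner numbers no longer occur, so the counting is purely about digraphs.\<close>

definition candidates :: "'a set \<Rightarrow> ('a \<times> 'a) set \<Rightarrow> ('a \<times> 'a) set" where
  "candidates V W = {(i, j) \<in> V \<times> V. i \<noteq> j \<and> (j, i) \<notin> W \<and>
    (\<forall>x. (i, x) \<in> W \<longrightarrow> x = j) \<and> (\<forall>x. (x, j) \<in> W \<longrightarrow> x = i)}"

definition extremal :: "'a set \<Rightarrow> 'a set \<Rightarrow> 'a set \<Rightarrow> ('a \<times> 'a) set" where
  "extremal X Y U = (Y \<union> U) \<times> (X \<union> U) - Y \<times> X - Id"

text \<open>Here \<open>s\<close> counts the arcs common to \<open>C\<close> and \<open>W\<close>,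
  \<open>p\<close> and \<open>q\<close> the tails and heads of \<open>C\<close>, and
  \<open>c\<close> its arcs. Eliminating \<open>c\<close> through its two bounds leaves a finite
  check.\<close>

lemma candidates_rectangle_arith:
  fixes p q s c :: nat
  assumes "s \<le> p" "s \<le> q" "p \<le> 6" "q \<le> 6" "5 \<le> c"
    and "c \<le> s + (p - s) * (q - s)" "8 \<le> s + (6 - p) * (6 - q)"
  shows "s = 0 \<or> s = 1 \<and> p = 3 \<and> q = 3 \<and> c = 5"
proof -
  let ?N = "{0, 1, 2, 3, 4, 5, 6 :: nat}"
  have *: "\<forall>s\<in>?N. \<forall>p\<in>?N. \<forall>q\<in>?N. s \<le> p \<and> s \<le> q \<and> 5 \<le> s + (p - s) * (q - s) \<and>
      8 \<le> s + (6 - p) * (6 - q) \<longrightarrow>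
    s = 0 \<or> s = 1 \<and> p = 3 \<and> q = 3"
    by simp
  have "s \<in> ?N" "p \<in> ?N" "q \<in> ?N" using assms(1-4) by auto
  from bspec[OF bspec[OF bspec[OF * this(1)] this(2)] this(3)]
  have "s = 0 \<or> s = 1 \<and> p = 3 \<and> q = 3" using assms by linarith
  then show ?thesis using assms(5,6) by auto
qed

text \<open>
  Here \<open>t\<close> is the size of \<open>P \<inter> Q\<close>, while \<open>\<alpha>\<close> and \<open>\<beta>\<close> count the candidates in \<open>X \<times> Y\<close> and the arcs
  of \<open>W\<close> in \<open>Y \<times> X\<close>; the reverse of a candidate is never in \<open>W\<close>, so \<open>\<alpha> + \<beta> \<le> x * y\<close>.
\<close>

lemma candidates_partition_arith:
  fixes x y t u c \<alpha> \<beta> :: nat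
  assumes "x + y + t + u = 6" "5 \<le> c"
    and "c \<le> ((x + t) * (y + t) - (t + x * y)) + \<alpha>"
    and "8 \<le> ((y + u) * (x + u) - (u + y * x)) + \<beta>"
    and "\<alpha> + \<beta> \<le> x * y"
  shows "c = 5" "t = 1" "u = 2" "\<beta> = 0" "x = 1 \<and> y = 2 \<or> x = 2 \<and> y = 1"
proof -
  let ?N = "{0, 1, 2, 3, 4, 5, 6 :: nat}"
  \<comment> \<open>The last premise adds the bounds for \<open>C\<close> and \<open>W\<close>, 5 +
    8 = 13, so that \<alpha> + \<beta> can be replaced by \<open>x * y\<close>.\<close>
  have *: "\<forall>x\<in>?N. \<forall>y\<in>?N. \<forall>t\<in>?N. x + y + t \<le> 6 \<and>
    5 \<le> ((x + t) * (y + t) - (t + x * y)) + x * y \<and>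
    8 \<le> ((y + (6 - x - y - t)) * (x + (6 - x - y - t)) - ((6 - x - y - t) + y * x)) + x * y \<and>
    13 \<le> ((x + t) * (y + t) - (t + x * y))
      + ((y + (6 - x - y - t)) * (x + (6 - x - y - t)) - ((6 - x - y - t) + y * x)) + x * y \<longrightarrow>
    t = 1 \<and> (x = 1 \<and> y = 2 \<or> x = 2 \<and> y = 1)"
    by simp
  have u: "u = 6 - x - y - t" using assms(1) by simp
  have "x \<in> ?N" "y \<in> ?N" "t \<in> ?N" using assms(1) by auto
  from bspec[OF bspec[OF bspec[OF * this(1)] this(2)] this(3)]
  have "t = 1 \<and> (x = 1 \<and> y = 2 \<or> x = 2 \<and> y = 1)"
    unfolding u[symmetric] using assms by linarith
  then show "c = 5" "t = 1" "u = 2" "\<beta> = 0" "x = 1 \<and> y = 2 \<or> x = 2 \<and> y = 1"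
    using assms by auto
qed

lemma card_Id_on: "card (Id_on A) = card A"
proof -
  have "Id_on A = (\<lambda>x. (x, x)) ` A" by auto
  then show ?thesis by (simp add: card_image inj_on_def)
qed

text \<open>Since \<open>X\<close> and \<open>Y\<close> are disjoint, their product misses the
  diagonal, and the two removed sets are counted separately.\<close>

lemma card_product_minus_Id_rectangle:
  assumes "finite A" "finite B" "X \<subseteq> A" "Y \<subseteq> B" "X \<inter> Y = {}"
  shows "card (A \<times> B - Id - X \<times> Y) = card A * card B - (card (A \<inter> B) + card X * card Y)"
proof -
  have fin: "finite (Id_on (A \<inter> B))" "finite (X \<times> Y)" "finite X" "finite Y"
    using assms finite_subset[OF assms(3,1)] finite_subset[OF assms(4,2)]
    by (simp_all add: Id_on_def)
  have "A \<times> B - Id - X \<times> Y = A \<times> B - (Id_on (A \<inter> B) \<union> X \<times> Y)" by auto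
  moreover have "Id_on (A \<inter> B) \<union> X \<times> Y \<subseteq> A \<times> B" using assms by auto
  moreover have "card (Id_on (A \<inter> B) \<union> X \<times> Y) = card (A \<inter> B) + card X * card Y"
    using fin assms(5) by (subst card_Un_disjoint) (auto simp: card_Id_on card_cartesian_product)
  ultimately show ?thesis
    using fin by (simp add: card_Diff_subset card_cartesian_product)
qed

section \<open>The structure of a collection with at least five candidates\<close>

context
  fixes V :: "'a set" and W :: "('a \<times> 'a) set"
  assumes V: "finite V" "card V = 6" and W: "W \<subseteq> V \<times> V - Id" "card W = 8"
    and many: "5 \<le> card (candidates V W)"
begin

private abbreviation "C \<equiv> candidates V W"
private abbreviation "P \<equiv> fst ` C"
private abbreviation "Q \<equiv> snd ` C"

private lemma C_D:
  assumes "(i, j) \<in> C"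
  shows "i \<in> V" "j \<in> V" "i \<noteq> j" "(j, i) \<notin> W"
    "(i, x) \<in> W \<Longrightarrow> x = j" "(x, j) \<in> W \<Longrightarrow> x = i"
  using assms unfolding candidates_def by blast+

private lemma finites: "finite C" "finite W" "finite P" "finite Q" "C \<subseteq> V \<times> V" "P \<subseteq> V" "Q \<subseteq> V"
proof -
  show "C \<subseteq> V \<times> V" unfolding candidates_def by blast
  then show "finite C" using V(1) finite_subset by blast
  show "finite W" using V(1) W(1) finite_subset by blast
  show "finite P" "finite Q" using \<open>finite C\<close> by simp_all
  show "P \<subseteq> V" "Q \<subseteq> V" using \<open>C \<subseteq> V \<times> V\<close> by auto
qed

private lemma inj_on_W_candidates: "inj_on fst (C \<inter> W)" "inj_on snd (C \<inter> W)"
  using C_D(5,6) by (auto simp: inj_on_def)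

text \<open>A candidate that lies in \<open>W\<close> excludes every other candidate with the same
  tail or the same head.\<close>

private lemma candidates_outside:
  "C - W \<subseteq> (P - fst ` (C \<inter> W)) \<times> (Q - snd ` (C \<inter> W))"
proof (rule subrelI)
  fix i j assume ij: "(i, j) \<in> C - W"
  have "i \<in> P" "j \<in> Q" using ij by force+
  moreover have "i \<notin> fst ` (C \<inter> W)" using ij C_D(5)[of i j] by auto
  moreover have "j \<notin> snd ` (C \<inter> W)" using ij C_D(6)[of i j] by auto
  ultimately show "(i, j) \<in> (P - fst ` (C \<inter> W)) \<times> (Q - snd ` (C \<inter> W))" by blast
qed

text \<open>An arc of \<open>W\<close> that shares its tail or head with a candidate equals that
  candidate.\<close>

private lemma non_candidates: "W - C \<subseteq> (V - P) \<times> (V - Q)"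
proof (rule subrelI)
  fix i j assume ij: "(i, j) \<in> W - C"
  have "i \<in> V" "j \<in> V" using ij W(1) by auto
  moreover have "i \<notin> P" using ij C_D(5)[of i _ j] by auto
  moreover have "j \<notin> Q" using ij C_D(6)[of _ j i] by auto
  ultimately show "(i, j) \<in> (V - P) \<times> (V - Q)" by blast
qed

private lemma cards_Diff: "card (V - P) = 6 - card P" "card (V - Q) = 6 - card Q"
  using finites V by (simp_all add: card_Diff_subset)

text \<open>The rectangle count leaves one exception: a single common arc, three tails, three heads,
  five candidates. There \<open>C - W\<close> fills a 2 by 2 rectangle, and \<open>W - C\<close>
  must avoid the diagonal and the reverses of these candidates. That leaves at most 6 places in a 3
  by 3 square for 7 arcs.\<close>

private lemma no_common_arc: "C \<inter> W = {}"
proof -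
  let ?D = "C \<inter> W"
  let ?P0 = "P - fst ` ?D" and ?Q0 = "Q - snd ` ?D"
  have finD: "finite ?D" using finites by blast
  have sub: "fst ` ?D \<subseteq> P" "snd ` ?D \<subseteq> Q" by blast+
  have imD: "card (fst ` ?D) = card ?D" "card (snd ` ?D) = card ?D"
    using inj_on_W_candidates by (simp_all add: card_image)
  have P0: "card ?P0 = card P - card ?D" and Q0: "card ?Q0 = card Q - card ?D"
    using finD sub imD by (simp_all add: card_Diff_subset)
  have C_split: "card C = card ?D + card (C - W)"
    using finites by (metis card_Int_Diff)
  have W_split: "card W = card ?D + card (W - C)"
    using finites by (metis card_Int_Diff Int_commute)
  have cC: "card (C - W) \<le> card ?P0 * card ?Q0"
    using card_mono[OF _ candidates_outside] finites by (simp add: card_cartesian_product)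
  have cW: "card (W - C) \<le> card (V - P) * card (V - Q)"
    using card_mono[OF _ non_candidates] V(1) by (simp add: card_cartesian_product)
  have sp: "card ?D \<le> card P" "card ?D \<le> card Q"
    using imD card_mono[OF _ sub(1)] card_mono[OF _ sub(2)] finites by simp_all
  have p6: "card P \<le> 6" "card Q \<le> 6"
    using card_mono[OF V(1) finites(6)] card_mono[OF V(1) finites(7)] V(2) by simp_all
  have "card ?D = 0 \<or> card ?D = 1 \<and> card P = 3 \<and> card Q = 3 \<and> card C = 5"
  proof (rule candidates_rectangle_arith[OF sp p6 many])
    show "card C \<le> card ?D + (card P - card ?D) * (card Q - card ?D)"
      using C_split cC unfolding P0 Q0 by linarith
    show "8 \<le> card ?D + (6 - card P) * (6 - card Q)"
      using W_split cW W(2) unfolding cards_Diff by linarith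
  qed
  moreover have False if one: "card ?D = 1" "card P = 3" "card Q = 3" "card C = 5"
  proof -
    obtain i0 j0 where D: "?D = {(i0, j0)}"
      using one(1) by (metis card_1_singletonE surj_pair)
    have ij: "(i0, j0) \<in> C" using D by blast
    have ne: "i0 \<noteq> j0" using C_D(3)[OF ij] .
    define P0 Q0 where "P0 = P - {i0}" and "Q0 = Q - {j0}"
    have i0: "i0 \<in> P" and j0: "j0 \<in> Q" using ij by force+
    have card0: "card P0 = 2" "card Q0 = 2" and fin0: "finite P0" "finite Q0"
      using i0 j0 one finites by (simp_all add: P0_def Q0_def)
    have CD: "C - W = P0 \<times> Q0"
    proof (rule card_subset_eq)
      show "C - W \<subseteq> P0 \<times> Q0" using candidates_outside unfolding D by (simp add: P0_def Q0_def)
      show "card (C - W) = card (P0 \<times> Q0)"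
        using C_split one card0 by (simp add: card_cartesian_product)
    qed (simp add: fin0)
    have disj: "P0 \<inter> Q0 = {}"
    proof -
      have "i \<notin> Q0" if "i \<in> P0" for i
      proof
        assume "i \<in> Q0"
        then have "(i, i) \<in> C" using CD that by blast
        then show False using C_D(3) by blast
      qed
      then show ?thesis by blast
    qed
    \<comment> \<open>The reverses in \<open>?X \<times> ?Y\<close> are exactly the ones that fall
      inside the square \<open>(V - P) \<times> (V - Q)\<close>.\<close>
    let ?X = "Q0 - {i0}" and ?Y = "P0 - {j0}"
    have notW: "(b, a) \<notin> W" if "a \<in> P0" "b \<in> Q0" for a b
    proof -
      have "(a, b) \<in> C" using CD that by blast
      then show ?thesis using C_D(4) by blast
    qed
    have X: "?X \<subseteq> V - P"
      using disj finites(7) by (auto simp: P0_def Q0_def)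
    have Y: "?Y \<subseteq> V - Q"
      using disj finites(6) by (auto simp: P0_def Q0_def)
    have "W - C \<subseteq> (V - P) \<times> (V - Q) - Id - ?X \<times> ?Y"
      using non_candidates W(1) notW by blast
    then have "card (W - C) \<le> card ((V - P) \<times> (V - Q) - Id - ?X \<times> ?Y)"
      using V(1) by (intro card_mono) auto
    also have "\<dots> = card (V - P) * card (V - Q)
        - (card ((V - P) \<inter> (V - Q)) + card ?X * card ?Y)"
      using X Y V(1) disj by (intro card_product_minus_Id_rectangle) auto
    also have "card (V - P) * card (V - Q) = 9"
      unfolding cards_Diff one by simp
    finally have le: "card (W - C) \<le> 9 - (card ((V - P) \<inter> (V - Q)) + card ?X * card ?Y)" .
    have PQ: "card ((V - P) \<inter> (V - Q)) = card (P \<inter> Q)"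
    proof -
      have "card (P \<union> Q) + card (P \<inter> Q) = 6"
        using card_Un_Int[of P Q] finites one by simp
      moreover have "(V - P) \<inter> (V - Q) = V - (P \<union> Q)" by blast
      moreover have "card (V - (P \<union> Q)) = 6 - card (P \<union> Q)"
        using finites V by (subst card_Diff_subset) auto
      ultimately show ?thesis by simp
    qed
    \<comment> \<open>If \<open>i0\<close> is lost from \<open>?X\<close> or \<open>j0\<close> from
      \<open>?Y\<close>, it reappears in \<open>P \<inter> Q\<close> and hence in the diagonal
      count. With \<open>a\<close> and \<open>b\<close> the two losses, a + b + (2 - a)(2 - b) is at
      least 3.\<close>
    have "card ({i0} \<inter> Q0 \<union> {j0} \<inter> P0) \<le> card (P \<inter> Q)"
      using finites i0 j0 by (intro card_mono) (auto simp: P0_def Q0_def)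
    moreover have "card ({i0} \<inter> Q0 \<union> {j0} \<inter> P0) = card ({i0} \<inter> Q0) + card ({j0} \<inter> P0)"
      using ne by (intro card_Un_disjoint) auto
    moreover have "card ?X = 2 - card ({i0} \<inter> Q0)" "card ?Y = 2 - card ({j0} \<inter> P0)"
      using card0 fin0 by (simp_all add: card_Diff_singleton_if)
    moreover have "card ({i0} \<inter> Q0) = 0 \<or> card ({i0} \<inter> Q0) = 1"
      "card ({j0} \<inter> P0) = 0 \<or> card ({j0} \<inter> P0) = 1"
      by auto
    ultimately have "3 \<le> card (P \<inter> Q) + card ?X * card ?Y"
      by (elim disjE) simp_all
    then have "card (W - C) \<le> 6" using le PQ by linarith
    then show False using W_split W(2) one(1) by linarith
  qed
  ultimately have "card ?D = 0" by blast
  then show ?thesis using finD by simp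
qed

text \<open>Now \<open>C\<close> and \<open>W\<close> lie in complementary rectangles off the
  diagonal. Splitting off \<open>X \<times> Y\<close> from \<open>C\<close> and
  \<open>Y \<times> X\<close> from \<open>W\<close> supplies the hypotheses of
  \<open>candidates_partition_arith\<close>.\<close>

lemma extremal_if_five_candidates:
  obtains X Y U where "X \<subseteq> V" "Y \<subseteq> V" "U \<subseteq> V" "X \<inter> Y = {}" "X \<inter> U = {}" "Y \<inter> U = {}"
    "card U = 2" "card X = 1 \<and> card Y = 2 \<or> card X = 2 \<and> card Y = 1"
    "W = extremal X Y U" "card (candidates V W) = 5" "candidates V W \<inter> W = {}"
proof -
  define X Y U where "X = P - Q" and "Y = Q - P" and "U = V - (P \<union> Q)"
  have P: "P = X \<union> (P \<inter> Q)" and Q: "Q = Y \<union> (P \<inter> Q)"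
    and VP: "V - P = Y \<union> U" and VQ: "V - Q = X \<union> U"
    and disj: "X \<inter> Y = {}" "Y \<inter> X = {}" "X \<inter> U = {}" "Y \<inter> U = {}"
    and sub: "X \<subseteq> V" "Y \<subseteq> V" "U \<subseteq> V"
    using finites(6,7) by (auto simp: X_def Y_def U_def)
  have fin: "finite X" "finite Y" "finite U" "finite (P \<inter> Q)"
    using sub V(1) finites(3) finite_subset by blast+
  have cP: "card P = card X + card (P \<inter> Q)"
    by (subst P, subst card_Un_disjoint) (use fin in \<open>auto simp: X_def\<close>)
  have cQ: "card Q = card Y + card (P \<inter> Q)"
    by (subst Q, subst card_Un_disjoint) (use fin in \<open>auto simp: Y_def\<close>)
  have cVP: "card (V - P) = card Y + card U" and cVQ: "card (V - Q) = card X + card U"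
    unfolding VP VQ using fin disj by (simp_all add: card_Un_disjoint)
  have total: "card X + card Y + card (P \<inter> Q) + card U = 6"
  proof -
    have "card P \<le> 6" using card_mono[OF V(1) finites(6)] V(2) by simp
    then show ?thesis using cP cVP cards_Diff(1) by simp
  qed
  have C_sub: "C \<subseteq> P \<times> Q - Id"
  proof (rule subrelI)
    fix i j assume "(i, j) \<in> C"
    then show "(i, j) \<in> P \<times> Q - Id" using C_D(3) by force
  qed
  have W_sub: "W \<subseteq> (V - P) \<times> (V - Q) - Id"
    using non_candidates no_common_arc W(1) by blast
  have XY: "X \<subseteq> P" "Y \<subseteq> Q" "Y \<subseteq> V - P" "X \<subseteq> V - Q" using VP VQ by (auto simp: X_def Y_def)
  have C_le: "card C \<le> ((card X + card (P \<inter> Q)) * (card Y + card (P \<inter> Q))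
      - (card (P \<inter> Q) + card X * card Y)) + card (C \<inter> X \<times> Y)"
  proof -
    have "card C = card (C \<inter> X \<times> Y) + card (C - X \<times> Y)"
      by (rule card_Int_Diff[OF finites(1)])
    moreover have "card (C - X \<times> Y) \<le> card (P \<times> Q - Id - X \<times> Y)"
      using C_sub finites by (intro card_mono) auto
    moreover have "card (P \<times> Q - Id - X \<times> Y)
        = card P * card Q - (card (P \<inter> Q) + card X * card Y)"
      using XY disj finites by (intro card_product_minus_Id_rectangle)
    ultimately show ?thesis using cP cQ by simp
  qed
  have cWrect: "card ((V - P) \<times> (V - Q) - Id - Y \<times> X)
      = (card Y + card U) * (card X + card U) - (card U + card Y * card X)"
  proof -
    have "(V - P) \<inter> (V - Q) = U" by (auto simp: U_def)
    then show ?thesis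
      using XY disj V(1) cVP cVQ by (subst card_product_minus_Id_rectangle) auto
  qed
  have W_le: "8 \<le> ((card Y + card U) * (card X + card U) - (card U + card Y * card X))
      + card (W \<inter> Y \<times> X)"
  proof -
    have "card W = card (W \<inter> Y \<times> X) + card (W - Y \<times> X)"
      by (rule card_Int_Diff[OF finites(2)])
    moreover have "card (W - Y \<times> X) \<le> card ((V - P) \<times> (V - Q) - Id - Y \<times> X)"
      using W_sub V(1) by (intro card_mono) auto
    ultimately show ?thesis using cWrect W(2) by simp
  qed
  \<comment> \<open>Reversing the arcs of \<open>W\<close> in \<open>Y \<times> X\<close> moves them
    into \<open>X \<times> Y\<close>, where they avoid \<open>C\<close>.\<close>
  have reverse: "card (C \<inter> X \<times> Y) + card (W \<inter> Y \<times> X) \<le> card X * card Y"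
  proof -
    have "card (W \<inter> Y \<times> X) = card (prod.swap ` (W \<inter> Y \<times> X))"
      by (rule card_image[symmetric]) simp
    moreover have "card (C \<inter> X \<times> Y) + card (prod.swap ` (W \<inter> Y \<times> X))
        = card (C \<inter> X \<times> Y \<union> prod.swap ` (W \<inter> Y \<times> X))"
      using finites C_D(4) by (subst card_Un_disjoint) auto
    moreover have "\<dots> \<le> card (X \<times> Y)"
      using fin by (intro card_mono) auto
    ultimately show ?thesis by (simp add: card_cartesian_product)
  qed
  note arith = candidates_partition_arith[OF total many C_le W_le reverse]
  \<comment> \<open>With no arc of \<open>W\<close> in \<open>Y \<times> X\<close>, the remaining
    region has exactly eight arcs, so \<open>W\<close> fills it.\<close>
  have W_eq: "W = (V - P) \<times> (V - Q) - Id - Y \<times> X"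
  proof (rule card_subset_eq)
    have "W \<inter> Y \<times> X = {}" using arith(4) finites by simp
    then show "W \<subseteq> (V - P) \<times> (V - Q) - Id - Y \<times> X" using W_sub by blast
    show "card W = card ((V - P) \<times> (V - Q) - Id - Y \<times> X)"
      unfolding cWrect using W(2) arith(3,5) by auto
  qed (use V(1) in simp)
  show ?thesis
  proof (rule that[OF sub disj(1,3,4) arith(3,5) _ arith(1) no_common_arc])
    show "W = extremal X Y U"
      by (subst W_eq) (auto simp: VP VQ extremal_def)
  qed
qed

end

subsection \<open>Matchings for the extremal collections\<close>

definition builds :: "(nat \<times> nat) set \<Rightarrow> nat \<times> nat \<Rightarrow> bool" where
  "builds W T \<longleftrightarrow> (\<exists>m. bij_betw m W (corners T) \<and> (\<forall>e\<in>W. m e \<in> corners e))"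

lemma finite_arcs: "finite arcs"
  by (simp add: arcs_def)

lemma solutions_nonempty_iff_builds:
  assumes "W \<subseteq> arcs" "T \<in> arcs"
  shows "solutions (cube ` W) (cube T) \<noteq> {} \<longleftrightarrow> builds W T"
proof
  have inj: "inj_on cube W" using inj_on_cube assms(1) inj_on_subset by blast
  have corners: "corner_numbers (cube e) = corners e" if "e \<in> W" for e
    using corner_numbers_cube assms(1) that by blast
  {
    assume "solutions (cube ` W) (cube T) \<noteq> {}"
    then obtain \<sigma> where \<sigma>: "bij_betw \<sigma> (cube ` W) (corners T)"
      "\<forall>C\<in>cube ` W. \<sigma> C \<in> corner_numbers C"
      using corner_numbers_cube[OF assms(2)] by (auto simp: solutions_def)
    have "bij_betw (\<sigma> \<circ> cube) W (corners T)"
      using bij_betw_trans[OF inj_on_imp_bij_betw[OF inj] \<sigma>(1)] .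
    then show "builds W T"
      using \<sigma>(2) corners unfolding builds_def by (intro exI[of _ "\<sigma> \<circ> cube"]) simp
  }
  assume "builds W T"
  then obtain m where m: "bij_betw m W (corners T)" "\<forall>e\<in>W. m e \<in> corners e"
    unfolding builds_def by blast
  \<comment> \<open>The restriction makes the transported matching extensional, as
    \<open>solutions\<close> demands.\<close>
  define \<sigma> where "\<sigma> = restrict (m \<circ> the_inv_into W cube) (cube ` W)"
  have "bij_betw (m \<circ> the_inv_into W cube) (cube ` W) (corners T)"
    using bij_betw_trans[OF bij_betw_the_inv_into[OF inj_on_imp_bij_betw[OF inj]] m(1)] .
  then have "bij_betw \<sigma> (cube ` W) (corners T)"
    by (rule bij_betw_cong[THEN iffD1, rotated]) (simp add: \<sigma>_def)
  moreover have "\<sigma> (cube e) = m e" if "e \<in> W" for e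
    using that the_inv_into_f_f[OF inj that] by (simp add: \<sigma>_def)
  moreover have "\<sigma> \<in> cube ` W \<rightarrow>\<^sub>E corners T"
    using \<open>bij_betw \<sigma> (cube ` W) (corners T)\<close>
    by (auto simp: bij_betw_def \<sigma>_def PiE_def extensional_def)
  ultimately have "\<sigma> \<in> solutions (cube ` W) (cube T)"
    using m(2) corners corner_numbers_cube[OF assms(2)] by (simp add: solutions_def)
  then show "solutions (cube ` W) (cube T) \<noteq> {}" by blast
qed

lemma targets_cube_image:
  assumes "W \<subseteq> arcs"
  shows "targets (cube ` W) = cube ` {T \<in> arcs. builds W T}"
proof -
  have "solution_number (cube ` W) (cube T) > 0 \<longleftrightarrow> builds W T" if "T \<in> arcs" for T
  proof -
    \<comment> \<open>An infinite set has cardinality 0, so finiteness of the solution set comes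
      before reading positivity as nonemptiness.\<close>
    have "finite (corners T)"
      using card_corners[OF that] by (intro card_ge_0_finite) simp
    moreover have "finite W" using assms finite_arcs finite_subset by blast
    ultimately have "finite (cube ` W \<rightarrow>\<^sub>E corners T)"
      by (intro finite_PiE) auto
    then have "finite (solutions (cube ` W) (cube T))"
      using corner_numbers_cube[OF that] by (simp add: solutions_def)
    then show ?thesis
      using solutions_nonempty_iff_builds[OF assms that]
      by (simp add: solution_number_def card_gt_0_iff)
  qed
  then show ?thesis
    by (auto simp: targets_def macmahon_cubes_eq)
qed

text \<open>The matching gives each cube of \<open>W\<close> a corner of \<open>T\<close>, so
  \<open>common_corner\<close> applies to every arc of \<open>W\<close>.\<close>

lemma candidate_if_builds:
  assumes "W \<subseteq> arcs" "T \<in> arcs" "builds W T"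
  shows "T \<in> candidates {..<6} W"
proof -
  obtain i j where T: "T = (i, j)" by fastforce
  obtain m where "bij_betw m W (corners T)" "\<forall>e\<in>W. m e \<in> corners e"
    using assms(3) unfolding builds_def by blast
  then have common: "corners (i, j) \<inter> corners e \<noteq> {}" if "e \<in> W" for e
    using that T bij_betwE by blast
  have ij: "(i, j) \<in> arcs" using assms(2) T by simp
  then have "i \<noteq> j" "i \<in> {..<6}" "j \<in> {..<6}" by (auto simp: arcs_def)
  moreover have "(j, i) \<notin> W"
    using common_corner(2)[OF ij subsetD[OF assms(1)] common, of j i] by blast
  moreover have "x = j" if "(i, x) \<in> W" for x
    using common_corner(1)[OF ij subsetD[OF assms(1) that] common[OF that]] by simp
  moreover have "x = i" if "(x, j) \<in> W" for x
    using common_corner(1)[OF ij subsetD[OF assms(1) that] common[OF that]] by simp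
  ultimately show ?thesis unfolding T candidates_def by blast
qed

section \<open>Matchings by pairs of triangles, and their symmetries\<close>

definition triangle_builds :: "(nat \<times> nat) set \<Rightarrow> nat \<times> nat \<Rightarrow> bool" where
  "triangle_builds W T \<longleftrightarrow>
    (\<exists>M. inj_on M W \<and> (\<forall>e\<in>W. M e \<in> triangle_pairs \<and> e \<in> M e \<and> T \<in> M e))"

lemma triangle_pairs_subset_arcs: "S \<in> triangle_pairs \<Longrightarrow> S \<subseteq> arcs"
proof -
  assume "S \<in> triangle_pairs"
  then obtain a b c d e f where S: "S = triangle a b c \<union> triangle d e f"
    "distinct [a, b, c, d, e, f]" "{a, b, c, d, e, f} = {..<6}"
    unfolding triangle_pairs_def by blast
  have "{a, b, c, d, e, f} \<subseteq> {..<6}" using S(3) by blast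
  then show ?thesis using S(2) by (simp add: S(1) triangle_def arcs_def eq_commute)
qed

text \<open>Each pair of triangles has a corner number \<kappa>, and the pair is recovered as the
  set of arcs having that corner; thus \<kappa> is injective. Eight cubes against eight corners turn
  injectivity into a bijection.\<close>

lemma builds_if_triangle_builds:
  assumes "W \<subseteq> arcs" "T \<in> arcs" "card W = 8" "triangle_builds W T"
  shows "builds W T"
proof -
  obtain M where M: "inj_on M W" "\<And>e. e \<in> W \<Longrightarrow> M e \<in> triangle_pairs \<and> e \<in> M e \<and> T \<in> M e"
    using assms(4) unfolding triangle_builds_def by blast
  have "\<exists>\<kappa>. \<forall>S\<in>triangle_pairs. \<forall>a\<in>arcs. \<kappa> S \<in> corners a \<longleftrightarrow> a \<in> S"
    by (intro bchoice ballI corner_of_triangle_pair)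
  then obtain \<kappa> where \<kappa>': "\<forall>S\<in>triangle_pairs. \<forall>a\<in>arcs. \<kappa> S \<in> corners a \<longleftrightarrow> a \<in> S" ..
  have \<kappa>: "\<kappa> S \<in> corners a \<longleftrightarrow> a \<in> S" if "S \<in> triangle_pairs" "a \<in> arcs" for S a
    by (rule \<kappa>'[rule_format, OF that])
  have "inj_on \<kappa> triangle_pairs"
  proof
    fix S S' assume S: "S \<in> triangle_pairs" "S' \<in> triangle_pairs" "\<kappa> S = \<kappa> S'"
    have "a \<in> S \<longleftrightarrow> a \<in> S'" if "a \<in> arcs" for a
      using \<kappa>[OF S(1) that] \<kappa>[OF S(2) that] S(3) by simp
    then show "S = S'"
      using triangle_pairs_subset_arcs[OF S(1)] triangle_pairs_subset_arcs[OF S(2)] by blast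
  qed
  moreover have "M ` W \<subseteq> triangle_pairs" using M(2) by blast
  ultimately have inj: "inj_on (\<kappa> \<circ> M) W"
    using M(1) inj_on_subset by (intro comp_inj_on)
  have \<kappa>M: "(\<kappa> \<circ> M) e \<in> corners T \<and> (\<kappa> \<circ> M) e \<in> corners e" if "e \<in> W" for e
    using \<kappa>[of "M e"] M(2)[OF that] subsetD[OF assms(1) that] assms(2) by simp
  then have sub: "(\<kappa> \<circ> M) ` W \<subseteq> corners T" by blast
  have "card ((\<kappa> \<circ> M) ` W) = card (corners T)"
    using card_image[OF inj] card_corners[OF assms(2)] assms(3) by simp
  moreover have "finite (corners T)"
    using card_corners[OF assms(2)] by (intro card_ge_0_finite) simp
  ultimately have "bij_betw (\<kappa> \<circ> M) W (corners T)"
    using inj card_subset_eq[OF _ sub] unfolding bij_betw_def by blast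
  moreover have "\<forall>e\<in>W. (\<kappa> \<circ> M) e \<in> corners e" using \<kappa>M by blast
  ultimately show ?thesis unfolding builds_def by blast
qed

text \<open>Stated for any injective map that preserves pairs of triangles, so as to cover both
  relabelling of points and reversal of arcs.\<close>

lemma triangle_builds_image:
  assumes "W \<subseteq> arcs" "inj_on f arcs"
    and pairs: "\<And>S. S \<in> triangle_pairs \<Longrightarrow> f ` S \<in> triangle_pairs"
    and "triangle_builds W T"
  shows "triangle_builds (f ` W) (f T)"
proof -
  obtain M where M: "inj_on M W" "\<And>e. e \<in> W \<Longrightarrow> M e \<in> triangle_pairs \<and> e \<in> M e \<and> T \<in> M e"
    using assms(4) unfolding triangle_builds_def by blast
  have inj: "inj_on f W" using assms(1,2) inj_on_subset by blast
  define M' where "M' = (\<lambda>e. f ` M (the_inv_into W f e))"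
  have M': "M' (f e) = f ` M e" if "e \<in> W" for e
    using the_inv_into_f_f[OF inj that] by (simp add: M'_def)
  have "inj_on M' (f ` W)"
  proof (rule inj_onI)
    fix a b assume "a \<in> f ` W" "b \<in> f ` W" and eq: "M' a = M' b"
    then obtain c d where cd: "c \<in> W" "d \<in> W" "a = f c" "b = f d" by blast
    then have "f ` M c = f ` M d" using eq M' by simp
    moreover have "M c \<subseteq> arcs" "M d \<subseteq> arcs"
      using M(2) cd triangle_pairs_subset_arcs by blast+
    ultimately have "M c = M d" by (simp add: inj_on_image_eq_iff[OF assms(2)])
    then show "a = b" using cd inj_onD[OF M(1) _ cd(1,2)] by simp
  qed
  moreover have "\<forall>e\<in>f ` W. M' e \<in> triangle_pairs \<and> e \<in> M' e \<and> f T \<in> M' e"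
  proof
    fix a assume "a \<in> f ` W"
    then obtain e where e: "e \<in> W" "a = f e" by blast
    then show "M' a \<in> triangle_pairs \<and> a \<in> M' a \<and> f T \<in> M' a"
      using M'[OF e(1)] M(2)[OF e(1)] pairs by simp
  qed
  ultimately show ?thesis unfolding triangle_builds_def by blast
qed

lemma map_prod_triangle: "map_prod g g ` triangle a b c = triangle (g a) (g b) (g c)"
  by (auto simp: triangle_def)

lemma swap_triangle: "prod.swap ` triangle a b c = triangle c b a"
  by (auto simp: triangle_def)

lemma relabel_triangle_pairs:
  assumes "bij_betw g {..<6} {..<6}" "S \<in> triangle_pairs"
  shows "map_prod g g ` S \<in> triangle_pairs"
proof -
  obtain a b c d e f where S: "S = triangle a b c \<union> triangle d e f"
    "distinct [a, b, c, d, e, f]" "{a, b, c, d, e, f} = {..<6}"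
    using assms(2) unfolding triangle_pairs_def by blast
  have "distinct (map g [a, b, c, d, e, f])"
    unfolding distinct_map using S(2,3) assms(1) by (simp add: bij_betw_def)
  moreover have "{g a, g b, g c, g d, g e, g f} = g ` {a, b, c, d, e, f}" by simp
  then have "{g a, g b, g c, g d, g e, g f} = {..<6}"
    unfolding S(3) using assms(1) by (simp add: bij_betw_def)
  moreover have "map_prod g g ` S = triangle (g a) (g b) (g c) \<union> triangle (g d) (g e) (g f)"
    by (simp add: S(1) image_Un map_prod_triangle)
  ultimately show ?thesis
    unfolding triangle_pairs_def list.map by blast
qed

lemma reverse_triangle_pairs:
  assumes "S \<in> triangle_pairs"
  shows "prod.swap ` S \<in> triangle_pairs"
proof -
  obtain a b c d e f where S: "S = triangle a b c \<union> triangle d e f"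
    "distinct [a, b, c, d, e, f]" "{a, b, c, d, e, f} = {..<6}"
    using assms unfolding triangle_pairs_def by blast
  have "prod.swap ` S = triangle c b a \<union> triangle f e d"
    by (simp add: S(1) image_Un swap_triangle)
  moreover have "distinct [c, b, a, f, e, d]" using S(2) by auto
  moreover have "{c, b, a, f, e, d} = {..<6}" unfolding S(3)[symmetric] by auto
  ultimately show ?thesis unfolding triangle_pairs_def by blast
qed

section \<open>Explicit matchings\<close>

fun triangle_pair :: "nat \<times> nat \<times> nat \<times> nat \<times> nat \<times> nat \<Rightarrow> (nat \<times> nat) set" where
  "triangle_pair (a, b, c, d, e, f) = triangle a b c \<union> triangle d e f"

lemma triangle_builds_list:
  assumes "distinct (map fst ps)" "distinct (map (triangle_pair \<circ> snd) ps)"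
    and "\<forall>(e, S)\<in>set ps. triangle_pair S \<in> triangle_pairs \<and> e \<in> triangle_pair S \<and> T \<in> triangle_pair S"
  shows "triangle_builds (set (map fst ps)) T"
proof -
  define M where "M = triangle_pair \<circ> the \<circ> map_of ps"
  have M: "M (fst x) = (triangle_pair \<circ> snd) x" if "x \<in> set ps" for x
    using assms(1) that by (cases x) (simp add: M_def)
  have "inj_on M (set (map fst ps))"
  proof (rule inj_onI)
    fix a b assume "a \<in> set (map fst ps)" "b \<in> set (map fst ps)" and eq: "M a = M b"
    then obtain x y where xy: "x \<in> set ps" "y \<in> set ps" "a = fst x" "b = fst y" by auto
    then have "(triangle_pair \<circ> snd) x = (triangle_pair \<circ> snd) y" using eq M by simp
    moreover have "inj_on (triangle_pair \<circ> snd) (set ps)"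
      using assms(2) unfolding distinct_map by blast
    ultimately have "x = y" using xy(1,2) by (simp only: inj_on_eq_iff)
    then show "a = b" using xy by simp
  qed
  moreover have "\<forall>e\<in>set (map fst ps). M e \<in> triangle_pairs \<and> e \<in> M e \<and> T \<in> M e"
  proof
    fix a assume "a \<in> set (map fst ps)"
    then obtain S where S: "(a, S) \<in> set ps" by auto
    have "triangle_pair S \<in> triangle_pairs \<and> a \<in> triangle_pair S \<and> T \<in> triangle_pair S"
      using bspec[OF assms(3) S] by simp
    then show "M a \<in> triangle_pairs \<and> a \<in> M a \<and> T \<in> M a"
      using M[OF S] by simp
  qed
  ultimately show ?thesis unfolding triangle_builds_def by blast
qed

lemma mem_triangle: "(p, q) \<in> triangle a b c \<longleftrightarrow> p = a \<and> q = b \<or> p = b \<and> q = c \<or> p = c \<and> q = a"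
  by (auto simp: triangle_def)

lemma triangle_pairsI:
  assumes "sort [a, b, c, d, e, f] = [0, 1, 2, 3, 4, 5]"
  shows "triangle a b c \<union> triangle d e f \<in> triangle_pairs"
proof -
  have "set (sort [a, b, c, d, e, f]) = {..<6}"
    unfolding assms lessThan_6 by simp
  then have "{a, b, c, d, e, f} = {..<6}" by (simp only: set_sort list.set)
  moreover have "distinct (sort [a, b, c, d, e, f])"
    unfolding assms by simp
  then have "distinct [a, b, c, d, e, f]" by (simp only: distinct_sort)
  ultimately show ?thesis
    unfolding triangle_pairs_def by blast
qed

text \<open>The point 5 is the one outside all three sets. The five candidates form
  \<open>{0, 5} \<times> {1, 2, 5} - Id\<close>, and exchanging 1 and 2 preserves the collection, so
  these three represent all of them.\<close>

lemma triangle_builds_standard: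
  assumes "T \<in> {(0, 1), (0, 5), (5, 1)}"
  shows "triangle_builds (extremal {0} {1, 2} {3, 4}) T"
proof -
  let ?A = "[((1, 3), (0, 1, 3, 2, 5, 4)), ((1, 4), (0, 1, 4, 2, 5, 3)),
    ((2, 3), (0, 1, 5, 2, 3, 4)), ((2, 4), (0, 1, 5, 2, 4, 3)), ((3, 0), (0, 1, 3, 2, 4, 5)),
    ((4, 0), (0, 1, 4, 2, 3, 5)), ((3, 4), (0, 1, 2, 3, 4, 5)), ((4, 3), (0, 1, 2, 3, 5, 4))]
    :: ((nat \<times> nat) \<times> nat \<times> nat \<times> nat \<times> nat \<times> nat \<times> nat) list"
  let ?B = "[((1, 3), (0, 5, 2, 1, 3, 4)), ((1, 4), (0, 5, 2, 1, 4, 3)),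
    ((2, 3), (0, 5, 4, 1, 2, 3)), ((2, 4), (0, 5, 3, 1, 2, 4)), ((3, 0), (0, 5, 3, 1, 4, 2)),
    ((4, 0), (0, 5, 4, 1, 3, 2)), ((3, 4), (0, 5, 1, 2, 3, 4)), ((4, 3), (0, 5, 1, 2, 4, 3))]
    :: ((nat \<times> nat) \<times> nat \<times> nat \<times> nat \<times> nat \<times> nat \<times> nat) list"
  let ?C = "[((1, 3), (5, 1, 3, 0, 4, 2)), ((1, 4), (5, 1, 4, 0, 3, 2)),
    ((2, 3), (5, 1, 0, 2, 3, 4)), ((2, 4), (5, 1, 0, 2, 4, 3)), ((3, 0), (5, 1, 4, 0, 2, 3)),
    ((4, 0), (5, 1, 3, 0, 2, 4)), ((3, 4), (5, 1, 2, 0, 3, 4)), ((4, 3), (5, 1, 2, 0, 4, 3))]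
    :: ((nat \<times> nat) \<times> nat \<times> nat \<times> nat \<times> nat \<times> nat \<times> nat) list"
  have A: "triangle_builds (set (map fst ?A)) (0, 1)"
    by (rule triangle_builds_list)
      (simp, simp add: triangle_def set_eq_subset, simp add: triangle_pairsI mem_triangle)
  have B: "triangle_builds (set (map fst ?B)) (0, 5)"
    by (rule triangle_builds_list)
      (simp, simp add: triangle_def set_eq_subset, simp add: triangle_pairsI mem_triangle)
  have C: "triangle_builds (set (map fst ?C)) (5, 1)"
    by (rule triangle_builds_list)
      (simp, simp add: triangle_def set_eq_subset, simp add: triangle_pairsI mem_triangle)
  have "extremal {0} {1, 2} {3, 4} =
      {(1, 3), (1, 4), (2, 3), (2, 4), (3, 0), (4, 0), (3, 4), (4, 3 :: nat)}"
    unfolding extremal_def by (simp add: set_eq_subset insert_Diff_if Sigma_def)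
  then show ?thesis using assms A B C by auto
qed

lemma extremal_swap: "prod.swap ` extremal X Y U = extremal Y X U"
  by (auto simp: extremal_def)

lemma extremal_image:
  assumes inj: "inj_on g V" and sub: "X \<subseteq> V" "Y \<subseteq> V" "U \<subseteq> V"
  shows "extremal (g ` X) (g ` Y) (g ` U) = map_prod g g ` extremal X Y U"
proof (intro equalityI subrelI)
  fix a b assume ab: "(a, b) \<in> extremal (g ` X) (g ` Y) (g ` U)"
  then obtain p q where pq: "p \<in> Y \<union> U" "q \<in> X \<union> U" "a = g p" "b = g q"
    unfolding extremal_def by blast
  then have "(p, q) \<in> extremal X Y U"
    using ab unfolding extremal_def by auto
  then show "(a, b) \<in> map_prod g g ` extremal X Y U"
    using pq(3,4) by force
next
  fix a b assume "(a, b) \<in> map_prod g g ` extremal X Y U"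
  then obtain p q where pq: "(p, q) \<in> extremal X Y U" "a = g p" "b = g q" by auto
  then have "p \<in> V" "q \<in> V" using sub unfolding extremal_def by blast+
  then have "a \<in> g ` Y \<longleftrightarrow> p \<in> Y" "b \<in> g ` X \<longleftrightarrow> q \<in> X" "a = b \<longleftrightarrow> p = q"
    using pq(2,3) inj_on_image_mem_iff[OF inj] inj_on_eq_iff[OF inj] sub by simp_all
  then show "(a, b) \<in> extremal (g ` X) (g ` Y) (g ` U)"
    using pq unfolding extremal_def by blast
qed

lemma triangle_builds_extremal_1_2:
  assumes "X \<subseteq> {..<6}" "Y \<subseteq> {..<6}" "U \<subseteq> {..<6}" "X \<inter> Y = {}" "X \<inter> U = {}" "Y \<inter> U = {}"
    and "card U = 2" "card X = 1" "card Y = 2"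
    and T: "T \<in> ({..<6} - Y - U) \<times> ({..<6} - X - U) - Id"
  shows "triangle_builds (extremal X Y U) T"
proof -
  obtain x where X: "X = {x}" using assms(8) by (metis card_1_singletonE)
  obtain u1 u2 where U: "U = {u1, u2}" "u1 \<noteq> u2" using assms(7) by (metis card_2_iff)
  obtain y y' where "Y = {y, y'}" "y \<noteq> y'" using assms(9) by (metis card_2_iff)
  \<comment> \<open>Naming the head of \<open>T\<close> as \<open>y1\<close> whenever it lies in
    \<open>Y\<close> uses up the symmetry between 1 and 2 in the standard collection.\<close>
  then obtain y1 y2 where Y: "Y = {y1, y2}" "y1 \<noteq> y2" "snd T \<in> Y \<longrightarrow> snd T = y1"
    by (metis insert_commute insert_iff singletonD)
  have fin: "finite X" "finite Y" "finite U" by (simp_all add: X Y U)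
  have "card (X \<union> Y \<union> U) = 5"
    using fin assms(4-9) by (simp add: card_Un_disjoint Int_Un_distrib2)
  moreover have "X \<union> Y \<union> U \<subseteq> {..<6}" using assms(1-3) by blast
  ultimately have "card ({..<6} - (X \<union> Y \<union> U)) = 1"
    using fin by (simp add: card_Diff_subset)
  then obtain z where z: "{..<6} - (X \<union> Y \<union> U) = {z}" by (metis card_1_singletonE)
  then have V: "{x, y1, y2, u1, u2, z} = {..<6}"
    using assms(1-3) by (auto simp: X Y U)
  have dist: "distinct [x, y1, y2, u1, u2, z]"
  proof (rule card_distinct)
    show "card (set [x, y1, y2, u1, u2, z]) = length [x, y1, y2, u1, u2, z]"
      using V by simp
  qed
  \<comment> \<open>The relabelling carries the standard collection to the given one, with
    \<open>z\<close>, the point outside \<open>X\<close>, \<open>Y\<close> and \<open>U\<close>, as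
    image of 5.\<close>
  define g where "g = nth [x, y1, y2, u1, u2, z]"
  have g: "g 0 = x" "g 1 = y1" "g 2 = y2" "g 3 = u1" "g 4 = u2" "g 5 = z"
    by (simp_all add: g_def)
  have bij: "bij_betw g {..<6} {..<6}"
    unfolding g_def using dist V by (intro bij_betw_nth) simp_all
  have XYU: "X = g ` {0}" "Y = g ` {1, 2}" "U = g ` {3, 4}"
    unfolding image_insert image_empty g X Y U by (rule refl)+
  have W: "extremal X Y U = map_prod g g ` extremal {0} {1, 2} {3, 4}"
    unfolding XYU using bij by (intro extremal_image[of g "{..<6}"]) (simp_all add: bij_betw_def)
  obtain i j where ij: "T = (i, j)" by fastforce
  have "i \<in> {x, z}" "j \<in> {y1, z}" "i \<noteq> j"
    using T Y(3) V unfolding ij X Y(1) U(1) by auto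
  then have "T \<in> map_prod g g ` {(0, 1), (0, 5), (5, 1)}"
    unfolding image_insert image_empty map_prod_simp g ij by auto
  then obtain T0 where T0: "T = map_prod g g T0" "T0 \<in> {(0, 1), (0, 5), (5, 1)}"
    by (rule imageE)
  show ?thesis
    unfolding W T0(1)
  proof (rule triangle_builds_image)
    show "inj_on (map_prod g g) arcs"
      using bij by (intro inj_on_subset[OF map_prod_inj_on]) (auto simp: bij_betw_def arcs_def)
    show "map_prod g g ` S \<in> triangle_pairs" if "S \<in> triangle_pairs" for S
      using relabel_triangle_pairs[OF bij that] .
    show "triangle_builds (extremal {0} {1, 2} {3, 4}) T0"
      by (rule triangle_builds_standard[OF T0(2)])
  qed (auto simp: arcs_def extremal_def)
qed

section \<open>Parametrising and counting the extremal collections\<close>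

definition extremal_parameters :: "(nat set \<times> nat set \<times> nat set) set" where
  "extremal_parameters = {(U, X, Y). U \<subseteq> {..<6} \<and> card U = 2 \<and>
    X \<subseteq> {..<6} - U \<and> Y \<subseteq> {..<6} - U - X \<and> (card X = 1 \<and> card Y = 2 \<or> card X = 2 \<and> card Y = 1)}"

text \<open>Reversing all arcs exchanges \<open>X\<close> and \<open>Y\<close>, which reduces the
  case of sizes 2 and 1 to that of sizes 1 and 2.\<close>

lemma triangle_builds_extremal:
  assumes "(U, X, Y) \<in> extremal_parameters"
    and T: "T \<in> ({..<6} - Y - U) \<times> ({..<6} - X - U) - Id"
  shows "triangle_builds (extremal X Y U) T"
proof -
  have *: "X \<subseteq> {..<6}" "Y \<subseteq> {..<6}" "U \<subseteq> {..<6}" "X \<inter> Y = {}" "Y \<inter> X = {}" "X \<inter> U = {}"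
    "Y \<inter> U = {}" "card U = 2" "card X = 1 \<and> card Y = 2 \<or> card X = 2 \<and> card Y = 1"
    using assms(1) by (auto simp: extremal_parameters_def)
  from *(9) show ?thesis
  proof
    assume "card X = 1 \<and> card Y = 2"
    then show ?thesis using triangle_builds_extremal_1_2 * T by simp
  next
    assume "card X = 2 \<and> card Y = 1"
    moreover have "prod.swap T \<in> ({..<6} - X - U) \<times> ({..<6} - Y - U) - Id"
      using T by auto
    ultimately have "triangle_builds (extremal Y X U) (prod.swap T)"
      using triangle_builds_extremal_1_2 * by simp
    moreover have "extremal Y X U \<subseteq> arcs"
      using *(1-3) by (auto simp: extremal_def arcs_def)
    ultimately have "triangle_builds (prod.swap ` extremal Y X U) (prod.swap (prod.swap T))"
      by (intro triangle_builds_image reverse_triangle_pairs) simp_all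
    then show ?thesis by (simp add: extremal_swap)
  qed
qed

lemma extremal_subset_arcs:
  assumes "(U, X, Y) \<in> extremal_parameters"
  shows "extremal X Y U \<subseteq> arcs"
  using assms by (auto simp: extremal_parameters_def extremal_def arcs_def)

lemma card_extremal:
  assumes "(U, X, Y) \<in> extremal_parameters"
  shows "card (extremal X Y U) = 8"
    and "card (({..<6} - Y - U) \<times> ({..<6} - X - U) - Id) = 5"
proof -
  have *: "X \<subseteq> {..<6}" "Y \<subseteq> {..<6}" "U \<subseteq> {..<6}" "X \<inter> Y = {}" "Y \<inter> X = {}" "X \<inter> U = {}"
    "Y \<inter> U = {}" "card U = 2" and card: "card X = 1 \<and> card Y = 2 \<or> card X = 2 \<and> card Y = 1"
    using assms by (auto simp: extremal_parameters_def)
  have fin: "finite X" "finite Y" "finite U"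
    using *(1-3) finite_subset by blast+
  have "(Y \<union> U) \<inter> (X \<union> U) = U" using *(5) by blast
  then have "card ((Y \<union> U) \<times> (X \<union> U) - Id - Y \<times> X)
      = (card Y + 2) * (card X + 2) - (2 + card Y * card X)"
    using fin * by (subst card_product_minus_Id_rectangle) (auto simp: card_Un_disjoint)
  moreover have "extremal X Y U = (Y \<union> U) \<times> (X \<union> U) - Id - Y \<times> X"
    by (auto simp: extremal_def)
  moreover have "(card Y + 2) * (card X + 2) - (2 + card Y * card X) = 8"
    using card by (elim disjE conjE) simp_all
  ultimately show "card (extremal X Y U) = 8" by simp
  have eq: "{..<6} - Y - U = {..<6} - (Y \<union> U)" "{..<6} - X - U = {..<6} - (X \<union> U)"
    "({..<6} - (Y \<union> U)) \<inter> ({..<6} - (X \<union> U)) = {..<6} - (X \<union> Y \<union> U)"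
    by blast+
  have YU: "card ({..<6} - (Y \<union> U)) = 4 - card Y"
    using fin *(2,3,7,8) by (simp add: card_Diff_subset card_Un_disjoint)
  have XU: "card ({..<6} - (X \<union> U)) = 4 - card X"
    using fin *(1,3,6,8) by (simp add: card_Diff_subset card_Un_disjoint)
  have "card (X \<union> Y \<union> U) = card X + card Y + 2"
    using fin *(4,6-8) by (simp add: card_Un_disjoint Int_Un_distrib2)
  then have XYU: "card ({..<6} - (X \<union> Y \<union> U)) = 4 - (card X + card Y)"
    using fin *(1-3) by (simp add: card_Diff_subset)
  have "card (({..<6} - Y - U) \<times> ({..<6} - X - U) - Id)
      = (4 - card Y) * (4 - card X) - (4 - (card X + card Y))"
    using card_product_minus_Id_rectangle[of "{..<6} - (Y \<union> U)" "{..<6} - (X \<union> U)" "{}" "{}"]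
    unfolding eq YU XU XYU by simp
  also have "\<dots> = 5"
    using card by (elim disjE conjE) simp_all
  finally show "card (({..<6} - Y - U) \<times> ({..<6} - X - U) - Id) = 5" .
qed

text \<open>The two points of \<open>U\<close> are joined both ways, and all arcs from
  \<open>Y\<close> to \<open>U\<close> and from \<open>U\<close> to \<open>X\<close> are present, so
  no point drops out as tail or head.\<close>

lemma extremal_Domain_Range:
  assumes "(U, X, Y) \<in> extremal_parameters"
  shows "Domain (extremal X Y U) = Y \<union> U" "Range (extremal X Y U) = X \<union> U"
proof -
  have disj: "X \<inter> Y = {}" "X \<inter> U = {}" "Y \<inter> U = {}" and "card U = 2"
    using assms by (auto simp: extremal_parameters_def)
  then obtain u1 u2 where "U = {u1, u2}" "u1 \<noteq> u2" by (metis card_2_iff)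
  with disj show "Domain (extremal X Y U) = Y \<union> U" "Range (extremal X Y U) = X \<union> U"
    by (auto simp: extremal_def Domain_iff Range_iff)
qed

text \<open>The parameters are recovered from the arcs: \<open>U\<close> consists of the points that
  are both tails and heads, \<open>Y\<close> of the other tails and \<open>X\<close> of the other
  heads.\<close>

lemma inj_on_extremal: "inj_on (\<lambda>(U, X, Y). extremal X Y U) extremal_parameters"
proof (rule inj_onI, clarsimp)
  fix U X Y U' X' Y'
  assume p: "(U, X, Y) \<in> extremal_parameters" "(U', X', Y') \<in> extremal_parameters"
    and eq: "extremal X Y U = extremal X' Y' U'"
  have 1: "Y \<union> U = Y' \<union> U'" "X \<union> U = X' \<union> U'"
    using extremal_Domain_Range[OF p(1)] extremal_Domain_Range[OF p(2)] eq by simp_all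
  have 2: "X \<inter> Y = {}" "X \<inter> U = {}" "Y \<inter> U = {}" "X' \<inter> Y' = {}" "X' \<inter> U' = {}" "Y' \<inter> U' = {}"
    using p by (auto simp: extremal_parameters_def)
  have "U = (Y \<union> U) \<inter> (X \<union> U)" using 2 by blast
  also have "\<dots> = (Y' \<union> U') \<inter> (X' \<union> U')" unfolding 1 by (rule refl)
  also have "\<dots> = U'" using 2 by blast
  finally have "U = U'" .
  moreover have "X = (X \<union> U) - U" "X' = (X' \<union> U') - U'" "Y = (Y \<union> U) - U" "Y' = (Y' \<union> U') - U'"
    using 2 by blast+
  ultimately show "U = U' \<and> X = X' \<and> Y = Y'" using 1 by metis
qed

lemma card_extremal_parameters: "card extremal_parameters = 360"
proof -
  \<comment> \<open>\<open>F k\<close> collects the triples with \<open>card X = k\<close>. Choosing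
    \<open>U\<close>, then \<open>X\<close>, then \<open>Y\<close> gives 15 * (4 * 3 + 6 * 2) = 360
    in total.\<close>
  define F where "F k = (SIGMA U:{U. U \<subseteq> {..<6::nat} \<and> card U = 2}.
    SIGMA X:{X. X \<subseteq> {..<6} - U \<and> card X = k}. {Y. Y \<subseteq> {..<6} - U - X \<and> card Y = 3 - k})" for k
  have F: "extremal_parameters = F 1 \<union> F 2"
    by (auto simp: extremal_parameters_def F_def)
  have disj: "F 1 \<inter> F 2 = {}" by (auto simp: F_def)
  have fin: "finite (F k)" and card: "card (F k) = 15 * ((4 choose k) * ((4 - k) choose (3 - k)))" for k
  proof -
    have Y: "card {Y. Y \<subseteq> {..<6} - U - X \<and> card Y = 3 - k} = (4 - k) choose (3 - k)"
      if "U \<subseteq> {..<6}" "card U = 2" "X \<subseteq> {..<6} - U" "card X = k" for U X :: "nat set"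
    proof -
      have "finite U" "finite X" using that finite_subset by blast+
      then have "card ({..<6} - U - X) = 4 - k" using that by (simp add: card_Diff_subset)
      then show ?thesis by (simp add: n_subsets)
    qed
    have X: "card {X. X \<subseteq> {..<6} - U \<and> card X = k} = 4 choose k"
      if "U \<subseteq> {..<6}" "card U = 2" for U :: "nat set"
    proof -
      have "finite U" using that finite_subset by blast
      then have "card ({..<6} - U) = 4" using that by (simp add: card_Diff_subset)
      then show ?thesis by (simp add: n_subsets)
    qed
    have U: "card {U. U \<subseteq> {..<6::nat} \<and> card U = 2} = 15"
      by (simp add: n_subsets choose_two)
    show "finite (F k)"
      unfolding F_def by (intro finite_SigmaI) simp_all
    show "card (F k) = 15 * ((4 choose k) * ((4 - k) choose (3 - k)))"
      unfolding F_def by (simp add: X Y U)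
  qed
  have "card extremal_parameters = card (F 1) + card (F 2)"
    unfolding F by (rule card_Un_disjoint[OF fin fin disj])
  then show ?thesis unfolding card by (simp add: choose_two)
qed

text \<open>Assuming at least five targets, rather than exactly five, yields the upper bound and the
  description of the equality case at once.\<close>

lemma buildable_bound:
  assumes "W \<subseteq> arcs" "card W = 8" "5 \<le> card {T \<in> arcs. builds W T}"
  shows "card {T \<in> arcs. builds W T} = 5" "{T \<in> arcs. builds W T} \<inter> W = {}"
    "W \<in> (\<lambda>(U, X, Y). extremal X Y U) ` extremal_parameters"
proof -
  let ?B = "{T \<in> arcs. builds W T}"
  have sub: "?B \<subseteq> candidates {..<6} W"
    using candidate_if_builds[OF assms(1)] by blast
  have fin: "finite (candidates {..<6} W)"
    by (rule finite_subset[of _ "{..<6} \<times> {..<6}"]) (auto simp: candidates_def)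
  have le: "card ?B \<le> card (candidates {..<6} W)"
    using card_mono[OF fin sub] .
  have W: "W \<subseteq> {..<6} \<times> {..<6} - Id" using assms(1) by (simp add: arcs_def)
  have many: "5 \<le> card (candidates {..<6} W)" using le assms(3) by simp
  obtain X Y U where *: "X \<subseteq> {..<6}" "Y \<subseteq> {..<6}" "U \<subseteq> {..<6}" "X \<inter> Y = {}" "X \<inter> U = {}"
    "Y \<inter> U = {}" "card U = 2" "card X = 1 \<and> card Y = 2 \<or> card X = 2 \<and> card Y = 1"
    "W = extremal X Y U" "card (candidates {..<6} W) = 5" "candidates {..<6} W \<inter> W = {}"
    by (rule extremal_if_five_candidates[OF _ _ W assms(2) many]) simp_all
  show "card ?B = 5" using le *(10) assms(3) by simp
  show "?B \<inter> W = {}" using sub *(11) by blast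
  have "(U, X, Y) \<in> extremal_parameters"
    using *(1-8) by (auto simp: extremal_parameters_def)
  then show "W \<in> (\<lambda>(U, X, Y). extremal X Y U) ` extremal_parameters"
    using *(9) by force
qed

lemma card_buildable_extremal:
  assumes p: "(U, X, Y) \<in> extremal_parameters"
  shows "5 \<le> card {T \<in> arcs. builds (extremal X Y U) T}"
proof -
  let ?C = "({..<6} - Y - U) \<times> ({..<6} - X - U) - Id"
  have "?C \<subseteq> {T \<in> arcs. builds (extremal X Y U) T}"
  proof
    fix T assume T: "T \<in> ?C"
    then have "T \<in> arcs" by (auto simp: arcs_def)
    then show "T \<in> {T \<in> arcs. builds (extremal X Y U) T}"
      using builds_if_triangle_builds[OF extremal_subset_arcs[OF p] _ card_extremal(1)[OF p]
          triangle_builds_extremal[OF p T]] by blast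
  qed
  from card_mono[OF _ this] show ?thesis
    using card_extremal(2)[OF p] finite_arcs by simp
qed

theorem theorem2:
  shows "(\<forall>W\<in>collections. card (targets W) \<le> 5)
    \<and> card {W \<in> collections. card (targets W) = 5} = 360
    \<and> (\<forall>W\<in>collections. card (targets W) = 5 \<longrightarrow> targets W \<inter> W = {})"
proof -
  define E where "E = (\<lambda>(U, X, Y). extremal X Y U) ` extremal_parameters"
  \<comment> \<open>Collections correspond injectively to sets of eight arcs, so their number can be
    counted on the arc side.\<close>
  have inj_image: "inj_on ((`) cube) (Pow arcs)"
    using inj_on_cube by (rule inj_on_image_Pow)
  have inj: "inj_on cube A" if "A \<subseteq> arcs" for A
    using inj_on_cube that inj_on_subset by blast
  have card_targets: "card (targets (cube ` W)) = card {T \<in> arcs. builds W T}" if "W \<subseteq> arcs" for W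
    unfolding targets_cube_image[OF that] by (rule card_image) (rule inj, blast)
  have collection: "\<exists>A. A \<subseteq> arcs \<and> card A = 8 \<and> W = cube ` A" if "W \<in> collections" for W
  proof -
    obtain A where A: "A \<subseteq> arcs" "W = cube ` A"
      using \<open>W \<in> collections\<close> unfolding collections_def macmahon_cubes_eq
      by (metis (no_types, lifting) mem_Collect_eq subset_imageE)
    moreover have "card W = 8" using that by (simp add: collections_def)
    ultimately show ?thesis using card_image[OF inj[OF A(1)]] by auto
  qed
  have E: "A \<subseteq> arcs" "card A = 8" "card {T \<in> arcs. builds A T} = 5" if A: "A \<in> E" for A
  proof -
    obtain U X Y where p: "(U, X, Y) \<in> extremal_parameters" "A = extremal X Y U"
      using A unfolding E_def by auto
    show "A \<subseteq> arcs" "card A = 8"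
      using extremal_subset_arcs[OF p(1)] card_extremal(1)[OF p(1)] p(2) by simp_all
    then show "card {T \<in> arcs. builds A T} = 5"
      using buildable_bound(1) card_buildable_extremal[OF p(1)] p(2) by simp
  qed
  have "{W \<in> collections. card (targets W) = 5} = (`) cube ` E"
  proof
    show "{W \<in> collections. card (targets W) = 5} \<subseteq> (`) cube ` E"
    proof
      fix W assume W: "W \<in> {W \<in> collections. card (targets W) = 5}"
      then obtain A where A: "A \<subseteq> arcs" "card A = 8" "W = cube ` A"
        using collection by blast
      then have "A \<in> E"
        using W card_targets buildable_bound(3) unfolding E_def by simp
      then show "W \<in> (`) cube ` E" using A(3) by blast
    qed
    show "(`) cube ` E \<subseteq> {W \<in> collections. card (targets W) = 5}"
    proof (rule image_subsetI)
      fix A assume "A \<in> E"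
      note A = E[OF this]
      have "card (cube ` A) = 8" using card_image[OF inj[OF A(1)]] A(2) by simp
      then have "cube ` A \<in> collections"
        using A(1) by (auto simp: collections_def macmahon_cubes_eq)
      then show "cube ` A \<in> {W \<in> collections. card (targets W) = 5}"
        using card_targets[OF A(1)] A(3) by simp
    qed
  qed
  moreover have "card ((`) cube ` E) = card E"
    using E(1) by (intro card_image inj_on_subset[OF inj_image]) blast
  moreover have "card E = 360"
    unfolding E_def by (simp add: card_image[OF inj_on_extremal] card_extremal_parameters)
  moreover have "card (targets W) \<le> 5" if W: "W \<in> collections" for W
  proof -
    obtain A where A: "A \<subseteq> arcs" "card A = 8" "W = cube ` A"
      using collection[OF W] by blast
    \<comment> \<open>More than five targets would contradict the exact value five in
      \<open>buildable_bound\<close>.\<close>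
    show ?thesis
      using buildable_bound(1)[OF A(1,2)] card_targets[OF A(1)] A(3) by fastforce
  qed
  moreover have "targets W \<inter> W = {}" if W: "W \<in> collections" "card (targets W) = 5" for W
  proof -
    obtain A where A: "A \<subseteq> arcs" "card A = 8" "W = cube ` A"
      using collection[OF W(1)] by blast
    have "{T \<in> arcs. builds A T} \<inter> A = {}"
      using buildable_bound(2)[OF A(1,2)] card_targets[OF A(1)] A(3) W(2) by simp
    then have "cube ` {T \<in> arcs. builds A T} \<inter> cube ` A = {}"
      using A(1) inj_on_image_Int[OF inj_on_cube, of "{T \<in> arcs. builds A T}" A] by simp
    then show ?thesis using targets_cube_image[OF A(1)] A(3) by simp
  qed
  ultimately show ?thesis by simp
qed

end
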